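(* Let $d\ge 1$ and let $P$ be a dimension-wise equiangular $d$-dimensional polytope in Euclidean space $E^d$, with outer dihedral angles $\alpha_2,\dots,\alpha_d$. Then there exists $\varepsilon>0$ such that on $[0,\varepsilon]$ the volume function $W_P(r)=\mathrm{vol}_d(P(r))$ is a polynomial function and $$W_P(r)=\sum_{k=0}^d(-1)^{d-k}\,\Omega_k(P)\,\gamma_{k+1}\gamma_{k+2}\cdots\gamma_d\,\frac{r^{d-k}}{(d-k)!}\qquad\text{for all } r\in[0,\varepsilon],$$ where $\gamma_d=1$ and $\gamma_k=\tan\left(\frac{\alpha_{k+1}}{2}\right)\tan\left(\frac{\alpha_{k+2}}{2}\right)\cdots\tan\left(\frac{\alpha_d}{2}\right)$ for $1\le k\le d-1$ (and the empty product, for $k=d$ in the sum, equals $1$).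
   Context: A $d$-dimensional polytope in $E^d$ is a compact convex set with non-empty interior that is the intersection of finitely many closed half-spaces. A $0$-dimensional polytope is a point and its $0$-dimensional volume is $1$. If $\{\mathcal{H}_1,\dots,\mathcal{H}_m\}$ is a minimal collection of closed half-spaces whose intersection is $P$, the facets of $P$ are $F_j=P\cap\partial\mathcal{H}_j$; each is a $(d-1)$-dimensional polytope in its affine hull. For $r\ge0$, $P(r)=\{Q\in P:\mathrm{d}(Q,\partial P)\ge r\}$. A polytope is equiangular if all the dihedral angles between pairs of adjacent facets (facets meeting along a common ridge, i.e. a common codimension-$2$ face) are equal. For an equiangular $d$-dimensional polytope the outer dihedral angle is the value $\alpha_d$ such that $\langle N_i,N_j\rangle=\cos\alpha_d$ for any two different facets $F_i,F_j$ meeting along a common ridge, with $N_i,N_j$ their inner unit normal vectors. A $d$-dimensional polytope $P$ is dimension-wise equiangular, with outer dihedral angles $\alpha_2,\dots,\alpha_d$, if these are constants in $(0,\pi)$ such that, for every $k$ with $2\le k\le d$, every $k$-dimensional face $F$ of $P$ (including $P$ itself for $k=d$) is, within its affine hull, an equiangular polytope with outer dihedral angle $\alpha_k$. In particular every $1$-dimensional polytope is dimension-wise equiangular. For a $d$-dimensional polytope $P$ with facets $F_1,\dots,F_m$ and $0\le k\le d$, define inductively $\Omega_k(P)=\mathrm{vol}_d(P)$ if $k=d$, and $\Omega_k(P)=\sum_{i=1}^m\Omega_k(F_i)$ if $k<d$. *)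

theory Defs
  imports "HOL-Analysis.Analysis" "HOL-Computational_Algebra.Polynomial"
begin

definition inner_parallel :: "'a::euclidean_space set \<Rightarrow> real \<Rightarrow> 'a set" where
  "inner_parallel P r = {x \<in> P. r \<le> infdist x (frontier P)}"

definition adjacent_facets ::
    "'a::euclidean_space set \<Rightarrow> 'a set \<Rightarrow> 'a set \<Rightarrow> bool" where
  "adjacent_facets P F G \<longleftrightarrow> F facet_of P \<and> G facet_of P \<and> F \<noteq> G \<and>
     F \<inter> G face_of P \<and> aff_dim (F \<inter> G) = aff_dim P - 2"

text \<open>The normal of a facet is taken inside the affine hull of P: the first conjunct after
  the normalization puts N into the linear space of directions of that affine hull.\<close>
definition inner_unit_normal ::
    "'a::euclidean_space set \<Rightarrow> 'a set \<Rightarrow> 'a \<Rightarrow> bool" where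
  "inner_unit_normal P F N \<longleftrightarrow> norm N = 1 \<and>
     (\<exists>x \<in> affine hull P. \<exists>y \<in> affine hull P. N = x - y) \<and>
     (\<forall>x\<in>F. \<forall>y\<in>F. N \<bullet> (y - x) = 0) \<and>
     (\<forall>x\<in>F. \<forall>y\<in>P. N \<bullet> (y - x) \<ge> 0)"

definition equiangular :: "'a::euclidean_space set \<Rightarrow> real \<Rightarrow> bool" where
  "equiangular P \<alpha> \<longleftrightarrow>
     (\<forall>F G M N. adjacent_facets P F G \<and> inner_unit_normal P F M \<and> inner_unit_normal P G N
        \<longrightarrow> M \<bullet> N = cos \<alpha>)"

definition dimensionwise_equiangular ::
    "nat \<Rightarrow> 'a::euclidean_space set \<Rightarrow> (nat \<Rightarrow> real) \<Rightarrow> bool" where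
  "dimensionwise_equiangular d P \<alpha> \<longleftrightarrow>
     (\<forall>k\<in>{2..d}. 0 < \<alpha> k \<and> \<alpha> k < pi) \<and>
     (\<forall>k\<in>{2..d}. \<forall>F. F face_of P \<and> aff_dim F = int k \<longrightarrow> equiangular F (\<alpha> k))"

text \<open>Cartesian coordinates on the affine hull of S, with origin a and axes
  b 0, ..., b (k - 1); they exist exactly when S has dimension k.\<close>
definition orthonormal_frame ::
    "nat \<Rightarrow> 'a::euclidean_space set \<Rightarrow> 'a \<Rightarrow> (nat \<Rightarrow> 'a) \<Rightarrow> bool" where
  "orthonormal_frame k S a b \<longleftrightarrow>
     (\<forall>i<k. \<forall>j<k. b i \<bullet> b j = (if i = j then 1 else 0)) \<and>
     affine hull S = range (\<lambda>x :: nat \<Rightarrow> real. a + (\<Sum>i<k. x i *\<^sub>R b i))"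

text \<open>The k-dimensional volume of a k-dimensional set S is the Lebesgue measure of S in
  Cartesian coordinates of its affine hull. Two frames of the same affine hull differ by a
  rigid motion of the coordinate space, so the choice made here is immaterial.\<close>
definition vol :: "nat \<Rightarrow> 'a::euclidean_space set \<Rightarrow> real" where
  "vol k S = (SOME v. \<exists>a b. orthonormal_frame k S a b \<and>
     v = measure (\<Pi>\<^sub>M i\<in>{..<k}. lborel)
           {x \<in> space (\<Pi>\<^sub>M i\<in>{..<k}. lborel). a + (\<Sum>i<k. x i *\<^sub>R b i) \<in> S})"

lemma vol_0_singleton: "vol 0 {p} = 1"
proof -
  have frame: "orthonormal_frame 0 {p} a b \<longleftrightarrow> a = p" for a :: 'a and b
    by (auto simp: orthonormal_frame_def)
  have "measure (\<Pi>\<^sub>M i\<in>{..<0::nat}. (lborel :: real measure))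
          (space (\<Pi>\<^sub>M i\<in>{..<0::nat}. lborel)) = 1"
    by (simp add: space_PiM measure_def emeasure_PiM_empty)
  then show ?thesis
    by (simp add: vol_def frame)
qed

text \<open>The first argument is the dimension of P; only indices k up to that dimension are
  meaningful.\<close>
primrec Omega :: "nat \<Rightarrow> nat \<Rightarrow> 'a::euclidean_space set \<Rightarrow> real" where
  "Omega 0 k P = vol 0 P"
| "Omega (Suc d) k P =
     (if k < Suc d then (\<Sum>F\<in>{F. F facet_of P}. Omega d k F) else vol (Suc d) P)"

definition gam :: "nat \<Rightarrow> (nat \<Rightarrow> real) \<Rightarrow> nat \<Rightarrow> real" where
  "gam d \<alpha> k = (\<Prod>j=k+1..d. tan (\<alpha> j / 2))"

definition W :: "'a::euclidean_space set \<Rightarrow> real \<Rightarrow> real" where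
  "W P r = measure lebesgue (inner_parallel P r)"

end

theory Submission
  imports Defs
begin

text \<open>Let \<open>P\<close> be a dimension-wise equiangular \<open>d\<close>-dimensional polytope with facets \<open>F\<close>, inner unit
normals \<open>N\<^sub>F\<close> and signed distances \<open>l\<^sub>F\<close>, so that \<open>P(r)\<close> is the set of points of \<open>P\<close> with \<open>l\<^sub>F \<ge> r\<close> for all \<open>F\<close>.  Cut
\<open>P - P(r)\<close> into the layers \<open>L\<^sub>F\<close> of the points for which \<open>F\<close> is the nearest facet and \<open>l\<^sub>F < r\<close>.
Two layers overlap in a hyperplane only.  By Fubini along \<open>N\<^sub>F\<close>, the volume of \<open>L\<^sub>F\<close> is the integral
over \<open>0 \<le> s < r\<close> of the \<open>(d-1)\<close>-volume of
\<open>{y \<in> aff F. l\<^sub>J (y + s N\<^sub>F) \<ge> s for all facets J}\<close>.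

The geometric heart of the proof (\<open>inset_slice_eq\<close>) is that for small \<open>s\<close> this slice is again an
inner parallel body, namely \<open>F(t s)\<close> with \<open>t = tan (\<alpha>\<^sub>d / 2)\<close>.  Hence
\<open>W\<^sub>P(r) = vol P - (\<Sum>F. \<integral>\<^sub>0\<^sup>r W\<^sub>F(t s) ds)\<close>, and the formula follows by induction on \<open>d\<close>
(\<open>measure_inset\<close>), each integration contributing one factor \<open>t\<close> to all the lower \<open>\<gamma>\<^sub>j\<close>.

For a facet \<open>J\<close> adjacent to \<open>F\<close>, the condition \<open>l\<^sub>J (y + s N\<^sub>F) \<ge> s\<close> says that \<open>y\<close> has distance
at least \<open>t s\<close> from the ridge \<open>F \<inter> J\<close>: this is plane trigonometry (\<open>ridge_normal\<close>).  A facet disjoint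
from \<open>F\<close> imposes nothing when \<open>s\<close> is small.  The difficulty is a facet \<open>J\<close> that meets \<open>F\<close> in a
lower-dimensional face, as happens at the vertices of an octahedron.  Here one needs that at every
vertex \<open>v\<close> the supporting cone of \<open>P\<close> has an inscribed ball touching all its facets: there is a
direction \<open>w\<close> with \<open>N\<^sub>F \<bullet> w = 1\<close> for every facet \<open>F\<close> through \<open>v\<close> (\<open>corner_exists\<close>).

Such a corner vector is built by induction on the dimension.  If \<open>w\<^sub>F\<close> is the corner vector of the facet
\<open>F\<close> at \<open>v\<close>, then \<open>N\<^sub>F + t w\<^sub>F\<close> is the only candidate for \<open>w\<close>.  Expanding \<open>w\<^sub>F\<close> and \<open>w\<^sub>G\<close> once more, along
a common ridge, shows that adjacent facets have the same candidate (\<open>corner_adjacent_facets\<close>); all the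
facets through \<open>v\<close> are linked by chains of adjacent ones (\<open>facets_at_point_connected\<close>), so there is one
candidate, and it works.

Since the faces of \<open>P\<close> lie in different flats, their volumes are compared through Lebesgue measure in
orthonormal coordinates; that the choice of coordinates is immaterial (\<open>flat_measure_axes_unique\<close>) is a
uniqueness property of translation-invariant measures.\<close>

section \<open>Volume in orthonormal coordinates\<close>

definition orthonormal_axes :: "nat \<Rightarrow> (nat \<Rightarrow> 'a::euclidean_space) \<Rightarrow> bool" where
  "orthonormal_axes k b \<longleftrightarrow> (\<forall>i<k. \<forall>j<k. b i \<bullet> b j = (if i = j then 1 else 0))"

definition coord_measure :: "nat \<Rightarrow> (nat \<Rightarrow> real) measure" where
  "coord_measure k = (\<Pi>\<^sub>M i\<in>{..<k}. lborel)"

definition combine :: "nat \<Rightarrow> (nat \<Rightarrow> 'a::euclidean_space) \<Rightarrow> (nat \<Rightarrow> real) \<Rightarrow> 'a" where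
  "combine k b x = (\<Sum>i<k. x i *\<^sub>R b i)"

definition flat_measure :: "nat \<Rightarrow> 'a::euclidean_space \<Rightarrow> (nat \<Rightarrow> 'a) \<Rightarrow> 'a measure" where
  "flat_measure k a b = distr (coord_measure k) borel (\<lambda>x. a + combine k b x)"

interpretation coord: product_sigma_finite "\<lambda>_::nat. lborel :: real measure"
  by standard

lemma sigma_finite_coord_measure: "sigma_finite_measure (coord_measure k)"
  unfolding coord_measure_def by (rule coord.sigma_finite) simp

lemma combine_measurable [measurable]: "combine k b \<in> borel_measurable (coord_measure k)"
  unfolding combine_def coord_measure_def by measurable

lemma combine_add: "combine k b (\<lambda>i. x i + y i) = combine k b x + combine k b y"
  by (simp add: combine_def scaleR_add_left sum.distrib)

lemma combine_restrict [simp]: "combine k b (restrict x {..<k}) = combine k b x"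
  by (simp add: combine_def)

lemma combine_inner_axis:
  assumes "orthonormal_axes k b" "j < k"
  shows "combine k b x \<bullet> b j = x j"
proof -
  have "combine k b x \<bullet> b j = (\<Sum>i<k. x i * (b i \<bullet> b j))"
    by (simp add: combine_def inner_sum_left)
  also have "\<dots> = (\<Sum>i<k. if i = j then x i else 0)"
    using assms by (intro sum.cong) (auto simp: orthonormal_axes_def)
  finally show ?thesis using assms by simp
qed

lemma norm_combine:
  assumes "orthonormal_axes k b"
  shows "norm (combine k b x) ^ 2 = (\<Sum>i<k. (x i)^2)"
proof -
  have "norm (combine k b x) ^ 2 = combine k b x \<bullet> combine k b x"
    by (simp add: power2_norm_eq_inner)
  also have "\<dots> = combine k b x \<bullet> (\<Sum>i<k. x i *\<^sub>R b i)"
    by (simp add: combine_def)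
  also have "\<dots> = (\<Sum>i<k. (x i)^2)"
    using combine_inner_axis[OF assms] by (simp add: inner_sum_right power2_eq_square)
  finally show ?thesis .
qed

text \<open>Checked on boxes, where it is the translation invariance of Lebesgue measure on the line.\<close>

lemma coord_measure_translate:
  "distr (coord_measure k) (coord_measure k) (\<lambda>x. \<lambda>i\<in>{..<k}. x i + c i) = coord_measure k"
  (is "distr ?L ?L ?f = ?L")
proof -
  have [measurable]: "?f \<in> measurable ?L ?L"
    unfolding coord_measure_def by measurable
  have "distr ?L ?L ?f = (\<Pi>\<^sub>M i\<in>{..<k}. lborel)"
  proof (rule coord.PiM_eqI)
    show "sets (distr ?L ?L ?f) = sets (\<Pi>\<^sub>M i\<in>{..<k}. lborel)"
      by (simp add: coord_measure_def)
    fix A :: "nat \<Rightarrow> real set"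
    assume A: "\<And>i. i \<in> {..<k} \<Longrightarrow> A i \<in> sets lborel"
    have 1: "?f -` Pi\<^sub>E {..<k} A \<inter> space ?L = Pi\<^sub>E {..<k} (\<lambda>i. (\<lambda>x. x + c i) -` A i)"
      by (auto simp: coord_measure_def space_PiM PiE_def Pi_def extensional_def)
    have 2: "(\<lambda>x. x + c i) -` A i \<in> sets borel" if "i < k" for i
      using measurable_sets[of "\<lambda>x. x + c i" borel borel "A i"] A[of i] that by simp
    have 3: "emeasure lborel ((\<lambda>x. x + c i) -` A i) = emeasure lborel (A i)" if "i < k" for i
    proof -
      have "emeasure lborel (A i) = emeasure (distr lborel borel ((+) (c i))) (A i)"
        by (simp only: lborel_distr_plus)
      also have "\<dots> = emeasure lborel ((+) (c i) -` A i)"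
        using A[of i] that by (simp add: emeasure_distr)
      also have "(+) (c i) -` A i = (\<lambda>x. x + c i) -` A i"
        by (auto simp: add.commute)
      finally show ?thesis ..
    qed
    have "Pi\<^sub>E {..<k} A \<in> sets ?L"
      unfolding coord_measure_def using A by (intro sets_PiM_I_finite) auto
    then have "emeasure (distr ?L ?L ?f) (Pi\<^sub>E {..<k} A) = emeasure ?L (?f -` Pi\<^sub>E {..<k} A \<inter> space ?L)"
      by (simp add: emeasure_distr)
    also have "\<dots> = (\<Prod>i<k. emeasure lborel ((\<lambda>x. x + c i) -` A i))"
      unfolding 1 unfolding coord_measure_def using 2 by (subst coord.emeasure_PiM) auto
    also have "\<dots> = (\<Prod>i<k. emeasure lborel (A i))"
      using 3 by (intro prod.cong) auto
    finally show "emeasure (distr ?L ?L ?f) (Pi\<^sub>E {..<k} A) = (\<Prod>i<k. emeasure lborel (A i))" .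
  qed simp
  then show ?thesis by (simp add: coord_measure_def)
qed

lemma nn_integral_combine_translate:
  assumes [measurable]: "g \<in> borel_measurable borel"
  shows "(\<integral>\<^sup>+x. g (combine k b x + combine k b c) \<partial>coord_measure k)
    = (\<integral>\<^sup>+x. g (combine k b x) \<partial>coord_measure k)"
proof -
  let ?f = "\<lambda>x. \<lambda>i\<in>{..<k}. x i + c i"
  have [measurable]: "?f \<in> measurable (coord_measure k) (coord_measure k)"
    unfolding coord_measure_def by measurable
  have "(\<integral>\<^sup>+x. g (combine k b x) \<partial>coord_measure k)
      = (\<integral>\<^sup>+x. g (combine k b x) \<partial>distr (coord_measure k) (coord_measure k) ?f)"
    by (simp only: coord_measure_translate)
  also have "\<dots> = (\<integral>\<^sup>+x. g (combine k b (?f x)) \<partial>coord_measure k)"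
    by (subst nn_integral_distr) measurable
  finally show ?thesis by (simp add: combine_add)
qed

lemma emeasure_flat_measure:
  assumes [measurable]: "S \<in> sets borel"
  shows "emeasure (flat_measure k a b) S
    = (\<integral>\<^sup>+x. indicator S (a + combine k b x) \<partial>coord_measure k)"
proof -
  have "emeasure (flat_measure k a b) S = (\<integral>\<^sup>+x. indicator S x \<partial>flat_measure k a b)"
    by (simp add: flat_measure_def)
  also have "\<dots> = (\<integral>\<^sup>+x. indicator S (a + combine k b x) \<partial>coord_measure k)"
    unfolding flat_measure_def by (subst nn_integral_distr) measurable
  finally show ?thesis .
qed

lemma sets_flat_measure [simp, measurable_cong]: "sets (flat_measure k a b) = sets borel"
  by (simp add: flat_measure_def)

lemma space_flat_measure [simp]: "space (flat_measure k a b) = UNIV"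
  by (simp add: flat_measure_def)

text \<open>The unit ball serves below as the reference set on which two flat measures are compared: the length of
a vector is the Euclidean length of its coordinates in any orthonormal system, so the measure of the ball
does not depend on the axes, and a small and a large cube show that it is positive and finite.\<close>

lemma emeasure_flat_measure_ball:
  assumes "orthonormal_axes k b" "orthonormal_axes k b'"
  shows "emeasure (flat_measure k 0 b) (ball 0 1) = emeasure (flat_measure k 0 b') (ball 0 1)"
    and "emeasure (flat_measure k 0 b) (ball 0 r) < \<infinity>"
    and "emeasure (flat_measure k 0 b) (ball 0 1) \<noteq> 0"
proof -
  have n: "norm (combine k b x) = norm (combine k b' x)" for x
    using norm_combine[OF assms(1), of x] norm_combine[OF assms(2), of x]
    by (metis norm_ge_zero power2_eq_imp_eq)
  show "emeasure (flat_measure k 0 b) (ball 0 1) = emeasure (flat_measure k 0 b') (ball 0 1)"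
    by (simp add: emeasure_flat_measure indicator_def n)
  have D: "emeasure (flat_measure k 0 b) (ball 0 r)
      = emeasure (coord_measure k) {x \<in> space (coord_measure k). norm (combine k b x) < r}" for r
    unfolding flat_measure_def by (subst emeasure_distr) (auto intro!: arg_cong2[where f = emeasure])
  have m: "{x \<in> space (coord_measure k). norm (combine k b x) < r} \<in> sets (coord_measure k)" for r
    by measurable
  have cube: "emeasure (coord_measure k) (Pi\<^sub>E {..<k} (\<lambda>_. {-r..r})) = (\<Prod>i<k. emeasure lborel {-r..r})"
    for r :: real
    unfolding coord_measure_def by (subst coord.emeasure_PiM) auto
  have cubeS: "Pi\<^sub>E {..<k} (\<lambda>_. {-r..r}) \<in> sets (coord_measure k)" for r :: real
    unfolding coord_measure_def by (intro sets_PiM_I_finite) auto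
  have "{x \<in> space (coord_measure k). norm (combine k b x) < r} \<subseteq> Pi\<^sub>E {..<k} (\<lambda>_. {-r..r})"
  proof (clarsimp simp: coord_measure_def space_PiM PiE_def)
    fix x i assume x: "norm (combine k b x) < r" "i < k"
    have "norm (b i) = 1"
      using assms(1) x by (auto simp: orthonormal_axes_def norm_eq_1)
    then have "\<bar>x i\<bar> \<le> norm (combine k b x)"
      using combine_inner_axis[OF assms(1) x(2), of x] Cauchy_Schwarz_ineq2[of "combine k b x" "b i"] by simp
    then show "- r \<le> x i \<and> x i \<le> r" using x by linarith
  qed
  then have "emeasure (flat_measure k 0 b) (ball 0 r) \<le> (\<Prod>i<k. emeasure lborel {-r..r})"
    unfolding D cube[symmetric] using cubeS by (intro emeasure_mono) auto
  also have "\<dots> < \<infinity>"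
    by (cases "r \<ge> 0") (auto simp: ennreal_power power_less_top_ennreal)
  finally show "emeasure (flat_measure k 0 b) (ball 0 r) < \<infinity>" .
  let ?s = "1 / (real k + 1)"
  have "Pi\<^sub>E {..<k} (\<lambda>_. {-?s..?s}) \<subseteq> {x \<in> space (coord_measure k). norm (combine k b x) < 1}"
  proof
    fix x assume x: "x \<in> Pi\<^sub>E {..<k} (\<lambda>_. {-?s..?s})"
    have xi: "\<bar>x i\<bar> \<le> ?s" if "i < k" for i
    proof -
      have "x i \<in> {-?s..?s}" using x that by (auto simp: PiE_def Pi_def)
      then show ?thesis by auto
    qed
    have "norm (combine k b x) \<le> (\<Sum>i<k. norm (x i *\<^sub>R b i))"
      unfolding combine_def by (rule norm_sum)
    also have "\<dots> \<le> (\<Sum>i<k. ?s)"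
    proof (intro sum_mono)
      fix i assume "i \<in> {..<k}"
      then have "norm (b i) = 1" "\<bar>x i\<bar> \<le> ?s"
        using assms(1) xi by (auto simp: orthonormal_axes_def norm_eq_1)
      then show "norm (x i *\<^sub>R b i) \<le> ?s" by simp
    qed
    also have "\<dots> < 1" by simp
    finally show "x \<in> {x \<in> space (coord_measure k). norm (combine k b x) < 1}"
      using x by (auto simp: coord_measure_def space_PiM PiE_def)
  qed
  then have "(\<Prod>i<k. emeasure lborel {-?s..?s}) \<le> emeasure (flat_measure k 0 b) (ball 0 1)"
    unfolding D cube[symmetric] using m[of 1] by (intro emeasure_mono) auto
  moreover have "(\<Prod>i<k. emeasure lborel {-?s..?s}) = ennreal ((2 * ?s) ^ k)"
    by (simp add: ennreal_power)
  moreover have "(2 * ?s) ^ k > 0" by (intro zero_less_power) simp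
  ultimately show "emeasure (flat_measure k 0 b) (ball 0 1) \<noteq> 0"
    by (metis ennreal_eq_0_iff le_zero_eq not_le)
qed

text \<open>Two measures \<open>\<mu>\<close> and \<open>\<mu>'\<close> on the same subspace, both invariant under its translations, are
proportional.  Indeed, for a symmetric set \<open>B\<close>, the double integral of \<open>1\<^sub>A(x) 1\<^sub>B(y - x)\<close> over
\<open>\<mu>(dx) \<mu>'(dy)\<close> equals \<open>\<mu>(A) \<mu>'(B)\<close> when \<open>y\<close> is integrated first; the substitution of \<open>x + y\<close> for \<open>x\<close>
in the inner integral, with \<open>x\<close> integrated first, turns it into \<open>\<mu>(B) \<mu>'(A)\<close>.  With \<open>B\<close> the unit ball, the factor of proportionality is 1.\<close>

lemma flat_measure_axes_unique:
  assumes b: "orthonormal_axes k b" and b': "orthonormal_axes k b'"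
    and R: "range (combine k b) = range (combine k b')"
  shows "flat_measure k 0 b = flat_measure k 0 b'"
proof (rule measure_eqI)
  fix A :: "'a set" assume "A \<in> sets (flat_measure k 0 b)"
  then have [measurable]: "A \<in> sets borel" by simp
  let ?B = "ball 0 1 :: 'a set" and ?L = "coord_measure k"
  let ?T = "combine k b" and ?T' = "combine k b'"
  interpret L: sigma_finite_measure ?L by (rule sigma_finite_coord_measure)
  interpret LL: pair_sigma_finite ?L ?L ..
  \<comment> \<open>\<open>c\<close> and \<open>c'\<close> translate the coordinates of a vector between the two systems\<close>
  have "\<forall>x. \<exists>y. ?T x = ?T' y" "\<forall>y. \<exists>x. ?T' y = ?T x"
    using R by (blast, blast)
  then obtain c c' where c: "?T x = ?T' (c x)" and c': "?T' y = ?T (c' y)" for x y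
    by metis
  let ?I = "\<lambda>A x. indicator A x :: ennreal"
  have ind: "?I ?B (x - z) = ?I ?B (z - x)" for x z :: 'a
    by (auto simp: indicator_def norm_minus_commute)
  have [measurable]: "?B \<in> sets borel" by simp
  have mB: "(\<lambda>z. ?I ?B (z - w)) \<in> borel_measurable borel" for w :: 'a
    by measurable
  have "emeasure (flat_measure k 0 b) A * emeasure (flat_measure k 0 b') ?B
     = (\<integral>\<^sup>+x. ?I A (?T x) * (\<integral>\<^sup>+y. ?I ?B (?T' y) \<partial>?L) \<partial>?L)"
    by (subst nn_integral_multc) (auto simp: emeasure_flat_measure)
  also have "\<dots> = (\<integral>\<^sup>+x. ?I A (?T x) * (\<integral>\<^sup>+y. ?I ?B (?T' y - ?T x) \<partial>?L) \<partial>?L)"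
  proof (rule nn_integral_cong, rule arg_cong2[where f = "(*)"], rule refl)
    fix x
    have "(\<integral>\<^sup>+y. ?I ?B (?T' y - ?T x) \<partial>?L)
        = (\<integral>\<^sup>+y. (\<lambda>z. ?I ?B (z - ?T x)) (?T' y + ?T' (c x)) \<partial>?L)"
      by (simp only: nn_integral_combine_translate[OF mB])
    then show "(\<integral>\<^sup>+y. ?I ?B (?T' y) \<partial>?L) = (\<integral>\<^sup>+y. ?I ?B (?T' y - ?T x) \<partial>?L)"
      by (simp add: c)
  qed
  also have "\<dots> = (\<integral>\<^sup>+x. (\<integral>\<^sup>+y. ?I A (?T x) * ?I ?B (?T' y - ?T x) \<partial>?L) \<partial>?L)"
    by (simp add: nn_integral_cmult)
  also have "\<dots> = (\<integral>\<^sup>+y. (\<integral>\<^sup>+x. ?I A (?T x) * ?I ?B (?T' y - ?T x) \<partial>?L) \<partial>?L)"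
    by (rule LL.Fubini'[of "\<lambda>x y. ?I A (?T x) * ?I ?B (?T' y - ?T x)", symmetric]) measurable
  also have "\<dots> = (\<integral>\<^sup>+y. (\<integral>\<^sup>+x. ?I A (?T x + ?T' y) * ?I ?B (?T x) \<partial>?L) \<partial>?L)"
  proof (rule nn_integral_cong)
    fix y
    have "(\<integral>\<^sup>+x. ?I A (?T x) * ?I ?B (?T' y - ?T x) \<partial>?L)
      = (\<integral>\<^sup>+x. (\<lambda>z. ?I A z * ?I ?B (z - ?T' y)) (?T x) \<partial>?L)"
      by (simp add: ind)
    also have "\<dots> = (\<integral>\<^sup>+x. (\<lambda>z. ?I A z * ?I ?B (z - ?T' y)) (?T x + ?T (c' y)) \<partial>?L)"
      by (rule nn_integral_combine_translate[symmetric]) measurable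
    finally show "(\<integral>\<^sup>+x. ?I A (?T x) * ?I ?B (?T' y - ?T x) \<partial>?L)
      = (\<integral>\<^sup>+x. ?I A (?T x + ?T' y) * ?I ?B (?T x) \<partial>?L)"
      by (simp add: c')
  qed
  also have "\<dots> = (\<integral>\<^sup>+x. (\<integral>\<^sup>+y. ?I A (?T x + ?T' y) * ?I ?B (?T x) \<partial>?L) \<partial>?L)"
    by (rule LL.Fubini'[of "\<lambda>x y. ?I A (?T x + ?T' y) * ?I ?B (?T x)"]) measurable
  also have "\<dots> = (\<integral>\<^sup>+x. emeasure (flat_measure k 0 b') A * ?I ?B (?T x) \<partial>?L)"
  proof (rule nn_integral_cong)
    fix x
    have "(\<integral>\<^sup>+y. ?I A (?T x + ?T' y) * ?I ?B (?T x) \<partial>?L)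
      = (\<integral>\<^sup>+y. ?I A (?T' y + ?T' (c x)) \<partial>?L) * ?I ?B (?T x)"
      by (subst nn_integral_multc) (auto simp: c add.commute)
    then show "(\<integral>\<^sup>+y. ?I A (?T x + ?T' y) * ?I ?B (?T x) \<partial>?L)
      = emeasure (flat_measure k 0 b') A * ?I ?B (?T x)"
      by (simp add: nn_integral_combine_translate emeasure_flat_measure)
  qed
  also have "\<dots> = emeasure (flat_measure k 0 b') A * emeasure (flat_measure k 0 b) ?B"
    by (subst nn_integral_cmult) (auto simp: emeasure_flat_measure)
  finally have "emeasure (flat_measure k 0 b) A * emeasure (flat_measure k 0 b') ?B
    = emeasure (flat_measure k 0 b') A * emeasure (flat_measure k 0 b') ?B"
    by (simp add: emeasure_flat_measure_ball(1)[OF b b'])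
  then show "emeasure (flat_measure k 0 b) A = emeasure (flat_measure k 0 b') A"
    using emeasure_flat_measure_ball(2)[OF b' b', of 1] emeasure_flat_measure_ball(3)[OF b' b']
    by (metis ennreal_mult_divide_eq infinity_ennreal_def less_irrefl)
qed simp

lemma emeasure_flat_measure_shift:
  assumes [measurable]: "S \<in> sets borel"
  shows "emeasure (flat_measure k (a + v) b) S = emeasure (flat_measure k a b) {y. y + v \<in> S}"
proof -
  have [measurable]: "{y. y + v \<in> S} \<in> sets borel"
    using measurable_sets[of "\<lambda>y. y + v" borel borel S] by (simp add: vimage_def)
  show ?thesis
    by (simp add: emeasure_flat_measure indicator_def algebra_simps)
qed

lemma flat_measure_origin:
  "flat_measure k (a + combine k b c) b = flat_measure k a b"
proof (rule measure_eqI)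
  fix S assume "S \<in> sets (flat_measure k (a + combine k b c) b)"
  then have [measurable]: "S \<in> sets borel" by simp
  show "emeasure (flat_measure k (a + combine k b c) b) S = emeasure (flat_measure k a b) S"
    using nn_integral_combine_translate[of "\<lambda>z. indicator S (a + z)" k b c]
    by (simp add: emeasure_flat_measure algebra_simps)
qed simp

lemma orthonormal_frame_iff:
  "orthonormal_frame k S a b \<longleftrightarrow>
     orthonormal_axes k b \<and> affine hull S = range (\<lambda>x. a + combine k b x)"
  by (simp add: orthonormal_frame_def orthonormal_axes_def combine_def)

lemma flat_measure_frame_unique:
  assumes "orthonormal_frame k S a b" "orthonormal_frame k S a' b'"
  shows "flat_measure k a b = flat_measure k a' b'"
proof -
  have b: "orthonormal_axes k b" "orthonormal_axes k b'"
    and R: "range (\<lambda>x. a + combine k b x) = range (\<lambda>x. a' + combine k b' x)"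
    using assms by (auto simp: orthonormal_frame_iff)
  have z: "combine k b (\<lambda>_. 0) = 0" "combine k b' (\<lambda>_. 0) = 0" by (auto simp: combine_def)
  have "a' \<in> range (\<lambda>x. a + combine k b x)"
    unfolding R using z by (intro range_eqI[of _ _ "\<lambda>_. 0"]) simp
  then obtain c where c: "a' = a + combine k b c" by auto
  have sub: "combine k b (\<lambda>i. x i - y i) = combine k b x - combine k b y" for x y
    by (simp add: combine_def scaleR_diff_left sum_subtractf)
  have "range (combine k b) = range (combine k b')"
  proof (intro equalityI subsetI)
    fix v assume "v \<in> range (combine k b)"
    then obtain x where x: "v = combine k b x" by auto
    have "a + combine k b (\<lambda>i. c i + x i) \<in> range (\<lambda>x. a' + combine k b' x)"
      unfolding R[symmetric] by blast
    then show "v \<in> range (combine k b')" by (auto simp: combine_add x c)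
  next
    fix v assume "v \<in> range (combine k b')"
    then obtain x where x: "v = combine k b' x" by auto
    have "a' + combine k b' x \<in> range (\<lambda>x. a + combine k b x)"
      unfolding R by blast
    then obtain y where "a' + combine k b' x = a + combine k b y" by auto
    then have "v = combine k b (\<lambda>i. y i - c i)" by (simp add: c x sub algebra_simps)
    then show "v \<in> range (combine k b)" by blast
  qed
  then have e: "flat_measure k 0 b = flat_measure k 0 b'"
    by (rule flat_measure_axes_unique[OF b])
  have "flat_measure k a' b = flat_measure k a' b'"
  proof (rule measure_eqI)
    fix S assume "S \<in> sets (flat_measure k a' b)"
    then have "S \<in> sets borel" by simp
    then show "emeasure (flat_measure k a' b) S = emeasure (flat_measure k a' b') S"
      using emeasure_flat_measure_shift[of S k 0 a' b] emeasure_flat_measure_shift[of S k 0 a' b'] e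
      by simp
  qed simp
  then show ?thesis by (simp add: c flat_measure_origin)
qed

lemma emeasure_flat_measure_slices:
  assumes [measurable]: "S \<in> sets borel"
  shows "emeasure (flat_measure (Suc k) a b) S
    = (\<integral>\<^sup>+s. emeasure (flat_measure k a b) {y. y + s *\<^sub>R b k \<in> S} \<partial>lborel)"
proof -
  have [measurable]: "{y. y + s *\<^sub>R b k \<in> S} \<in> sets borel" for s
    using measurable_sets[of "\<lambda>y. y + s *\<^sub>R b k" borel borel S] by (simp add: vimage_def)
  have "(\<lambda>x. indicator S (a + combine (Suc k) b x) :: ennreal) \<in> borel_measurable (coord_measure (Suc k))"
    by measurable
  then have "emeasure (flat_measure (Suc k) a b) S
      = (\<integral>\<^sup>+s. (\<integral>\<^sup>+x. indicator S (a + combine (Suc k) b (x(k := s))) \<partial>coord_measure k) \<partial>lborel)"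
    unfolding coord_measure_def emeasure_flat_measure[OF assms] lessThan_Suc
    by (subst coord.product_nn_integral_insert_rev) auto
  moreover have "combine (Suc k) b (x(k := s)) = combine k b x + s *\<^sub>R b k" for x s
    by (simp add: combine_def)
  ultimately show ?thesis
    by (simp add: emeasure_flat_measure indicator_def algebra_simps)
qed

section \<open>Flats and their volume measures\<close>

definition directions :: "'a::euclidean_space set \<Rightarrow> 'a set" where
  "directions S = {x - y | x y. x \<in> affine hull S \<and> y \<in> affine hull S}"

lemma directions_iff:
  assumes "p \<in> affine hull S"
  shows "v \<in> directions S \<longleftrightarrow> p + v \<in> affine hull S"
proof
  assume "v \<in> directions S"
  then obtain x y where "v = x - y" "x \<in> affine hull S" "y \<in> affine hull S"
    by (auto simp: directions_def)
  then show "p + v \<in> affine hull S"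
    using mem_affine_3_minus[OF affine_affine_hull assms, of x y 1] by simp
next
  assume "p + v \<in> affine hull S"
  then show "v \<in> directions S"
    unfolding directions_def using assms by (intro CollectI exI[of _ "p + v"] exI[of _ p]) auto
qed

lemma directions_eq_translate:
  assumes "p \<in> affine hull S"
  shows "directions S = (+) (- p) ` (affine hull S)"
proof (intro equalityI subsetI)
  fix v assume "v \<in> directions S"
  then have "p + v \<in> affine hull S" using directions_iff[OF assms] by simp
  then show "v \<in> (+) (- p) ` (affine hull S)" by (rule rev_image_eqI) simp
next
  fix v assume "v \<in> (+) (- p) ` (affine hull S)"
  then show "v \<in> directions S" using directions_iff[OF assms] by force
qed

lemma subspace_directions:
  assumes "S \<noteq> {}"
  shows "subspace (directions S)"
proof -
  obtain p where "p \<in> affine hull S" using assms hull_inc by fast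
  then show ?thesis
    using directions_eq_translate affine_diffs_subspace[OF affine_affine_hull] by metis
qed

lemma diff_in_directions: "x \<in> affine hull S \<Longrightarrow> y \<in> affine hull S \<Longrightarrow> x - y \<in> directions S"
  by (auto simp: directions_def)

lemma orthonormal_frame_origin:
  assumes "orthonormal_frame k S a b"
  shows "a \<in> affine hull S"
proof -
  have "a + combine k b (\<lambda>_. 0) \<in> affine hull S"
    using assms by (auto simp: orthonormal_frame_iff)
  then show ?thesis by (simp add: combine_def)
qed

lemma orthonormal_frame_axis:
  assumes "orthonormal_frame k S a b" "i < k"
  shows "b i \<in> directions S"
proof -
  have "combine k b (\<lambda>j. if j = i then 1 else 0) = (\<Sum>j<k. if j = i then b j else 0)"
    unfolding combine_def by (intro sum.cong) auto
  then have "combine k b (\<lambda>j. if j = i then 1 else 0) = b i" using assms(2) by simp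
  then have "a + b i \<in> affine hull S"
    using assms(1) unfolding orthonormal_frame_iff by (metis rangeI)
  then show ?thesis using directions_iff orthonormal_frame_origin[OF assms(1)] by blast
qed

lemma orthonormal_frame_exists:
  assumes "aff_dim S = int k"
  obtains a b where "orthonormal_frame k S a b"
proof -
  have "S \<noteq> {}" using assms by auto
  then obtain a where a: "a \<in> affine hull S" using hull_inc by fast
  have D: "directions S = (+) (- a) ` (affine hull S)" by (rule directions_eq_translate[OF a])
  have sub: "subspace (directions S)" using \<open>S \<noteq> {}\<close> by (rule subspace_directions)
  have "aff_dim (affine hull S) = int (dim ((+) (- a) ` (affine hull S)))"
    by (rule aff_dim_eq_dim) (simp add: a)
  then have "dim (directions S) = k" using assms D by simp
  then obtain B where B: "B \<subseteq> directions S" "pairwise orthogonal B" "\<And>x. x \<in> B \<Longrightarrow> norm x = 1"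
    "card B = k" "span B = directions S" "independent B"
    using orthonormal_basis_subspace[OF sub] by metis
  then have "finite B" using independent_imp_finite by blast
  then obtain h where h: "bij_betw h {..<k} B"
    using ex_bij_betw_nat_finite[of B] B(4) by (auto simp: atLeast0LessThan)
  have "orthonormal_axes k h"
    unfolding orthonormal_axes_def
  proof (intro allI impI)
    fix i j assume ij: "i < k" "j < k"
    then have hB: "h i \<in> B" "h j \<in> B" using h bij_betwE by blast+
    show "h i \<bullet> h j = (if i = j then 1 else 0)"
    proof (cases "i = j")
      case True then show ?thesis using B(3)[OF hB(1)] by (simp add: norm_eq_1)
    next
      case False
      then have "h i \<noteq> h j" using h ij by (auto simp: bij_betw_def inj_on_def)
      then show ?thesis using B(2) hB False by (auto simp: pairwise_def orthogonal_def)
    qed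
  qed
  moreover have "affine hull S = range (\<lambda>x. a + combine k h x)"
  proof (intro equalityI subsetI)
    fix x assume "x \<in> affine hull S"
    then have "x - a \<in> span B" using a B(5) by (simp add: diff_in_directions)
    then obtain u where "x - a = (\<Sum>v\<in>B. u v *\<^sub>R v)"
      using span_finite[OF \<open>finite B\<close>] by auto
    also have "\<dots> = (\<Sum>i<k. u (h i) *\<^sub>R h i)"
      by (rule sum.reindex_bij_betw[OF h, symmetric])
    finally show "x \<in> range (\<lambda>x. a + combine k h x)"
      by (intro range_eqI[of _ _ "\<lambda>i. u (h i)"]) (simp add: combine_def algebra_simps)
  next
    fix x assume "x \<in> range (\<lambda>x. a + combine k h x)"
    then obtain c where c: "x = a + combine k h c" by auto
    have "combine k h c \<in> directions S"
      unfolding combine_def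
    proof (intro subspace_sum[OF sub] subspace_scale[OF sub])
      fix i assume "i \<in> {..<k}"
      then show "h i \<in> directions S" using h B(1) bij_betwE by blast
    qed
    then show "x \<in> affine hull S" using directions_iff[OF a] c by simp
  qed
  ultimately show thesis using that[of a h] by (simp add: orthonormal_frame_iff)
qed

text \<open>Coordinates of a hyperplane section of a flat, completed by the unit normal of the section, are
coordinates of the flat.  This is what makes Fubini along the normal of a facet available.\<close>

lemma orthonormal_frame_extend:
  assumes F: "orthonormal_frame k F a b" and p: "p \<in> affine hull F"
    and hull: "affine hull F = {x \<in> affine hull P. N \<bullet> (x - p) = 0}"
    and N: "N \<in> directions P" "norm N = 1"
  shows "orthonormal_frame (Suc k) P a (b(k := N))"
proof -
  have a: "a \<in> affine hull F" by (rule orthonormal_frame_origin[OF F])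
  then have aP: "a \<in> affine hull P" and aN: "N \<bullet> (a - p) = 0" using hull by auto
  have sub: "subspace (directions P)"
    using aP by (intro subspace_directions) auto
  have bN: "N \<bullet> b i = 0" if "i < k" for i
  proof -
    have "a + b i \<in> affine hull F"
      using orthonormal_frame_axis[OF F that] directions_iff[OF a] by simp
    then have "N \<bullet> (a + b i - p) = 0" using hull by auto
    then show ?thesis using aN by (simp add: inner_diff_right inner_add_right)
  qed
  have ax: "orthonormal_axes k b" and R: "affine hull F = range (\<lambda>x. a + combine k b x)"
    using F by (auto simp: orthonormal_frame_iff)
  have "orthonormal_axes (Suc k) (b(k := N))"
    using ax bN N(2) by (auto simp: orthonormal_axes_def less_Suc_eq norm_eq_1 inner_commute)
  moreover have comb: "combine (Suc k) (b(k := N)) x = combine k b x + x k *\<^sub>R N" for x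
    by (simp add: combine_def)
  have "affine hull P = range (\<lambda>x. a + combine (Suc k) (b(k := N)) x)"
  proof (intro equalityI subsetI)
    fix x assume x: "x \<in> affine hull P"
    define s where "s = N \<bullet> (x - a)"
    have "x - s *\<^sub>R N = x + (- s) *\<^sub>R N" by simp
    also have "\<dots> \<in> affine hull P"
      using directions_iff[OF x] subspace_scale[OF sub N(1)] by blast
    finally have "x - s *\<^sub>R N \<in> affine hull P" .
    moreover have "N \<bullet> (x - s *\<^sub>R N - p) = 0"
      using aN N(2) by (simp add: s_def inner_diff_right norm_eq_1)
    ultimately have "x - s *\<^sub>R N \<in> range (\<lambda>x. a + combine k b x)" using hull R by auto
    then obtain c where c: "x - s *\<^sub>R N = a + combine k b c" by auto
    have "combine k b (c(k := s)) = combine k b c" by (simp add: combine_def)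
    then have "x = a + combine (Suc k) (b(k := N)) (c(k := s))"
      using c by (simp add: comb algebra_simps)
    then show "x \<in> range (\<lambda>x. a + combine (Suc k) (b(k := N)) x)" by blast
  next
    fix x assume "x \<in> range (\<lambda>x. a + combine (Suc k) (b(k := N)) x)"
    then obtain c where c: "x = (a + combine k b c) + c k *\<^sub>R N" by (auto simp: comb)
    have "a + combine k b c \<in> affine hull P" using R hull by auto
    then show "x \<in> affine hull P"
      using directions_iff subspace_scale[OF sub N(1)] c by blast
  qed
  ultimately show ?thesis by (simp add: orthonormal_frame_iff)
qed

lemma aff_dim_hyperplane_section:
  assumes M: "M \<in> directions S" "M \<noteq> 0" and p: "p \<in> affine hull S"
  shows "aff_dim {x \<in> affine hull S. M \<bullet> (x - p) = 0} = aff_dim S - 1"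
    and "affine {x \<in> affine hull S. M \<bullet> (x - p) = 0}"
proof -
  have eq: "{x \<in> affine hull S. M \<bullet> (x - p) = 0} = affine hull S \<inter> {x. M \<bullet> x = M \<bullet> p}"
    by (auto simp: inner_diff_right)
  have 1: "p \<in> affine hull S \<inter> {x. M \<bullet> x = M \<bullet> p}" using p by simp
  have 2: "p + M \<in> affine hull S" using directions_iff[OF p] M by blast
  have 3: "M \<bullet> (p + M) \<noteq> M \<bullet> p" using M(2) by (simp add: inner_add_right)
  from 2 3 have "\<not> affine hull S \<subseteq> {x. M \<bullet> x = M \<bullet> p}" by blast
  then show "aff_dim {x \<in> affine hull S. M \<bullet> (x - p) = 0} = aff_dim S - 1"
    unfolding eq using aff_dim_affine_Int_hyperplane[OF affine_affine_hull, of S M "M \<bullet> p"] 1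
    by (auto simp: aff_dim_affine_hull)
  show "affine {x \<in> affine hull S. M \<bullet> (x - p) = 0}"
    unfolding eq by (intro affine_Int affine_affine_hull affine_hyperplane)
qed

text \<open>The \<open>k\<close>-dimensional volume as a measure on the whole space, concentrated on the affine hull of \<open>S\<close>.
Only the affine hull of \<open>S\<close> matters, so subsets of \<open>S\<close> of any dimension can be measured.\<close>

definition flat_vol :: "nat \<Rightarrow> 'a::euclidean_space set \<Rightarrow> 'a measure" where
  "flat_vol k S = (SOME \<mu>. \<exists>a b. orthonormal_frame k S a b \<and> \<mu> = flat_measure k a b)"

lemma flat_vol_eq:
  assumes "orthonormal_frame k S a b"
  shows "flat_vol k S = flat_measure k a b"
  unfolding flat_vol_def
proof (rule some_equality)
  show "\<exists>a' b'. orthonormal_frame k S a' b' \<and> flat_measure k a b = flat_measure k a' b'"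
    using assms by blast
  fix \<mu> assume "\<exists>a b. orthonormal_frame k S a b \<and> \<mu> = flat_measure k a b"
  then show "\<mu> = flat_measure k a b" using flat_measure_frame_unique[OF assms] by auto
qed

lemma sets_flat_vol [simp, measurable_cong]:
  assumes "aff_dim S = int k"
  shows "sets (flat_vol k S) = sets borel" and "space (flat_vol k S) = UNIV"
  using orthonormal_frame_exists[OF assms] flat_vol_eq by (metis sets_flat_measure, metis space_flat_measure)

lemma vol_eq_flat_vol:
  assumes "aff_dim S = int k" and [measurable]: "S \<in> sets borel"
  shows "vol k S = measure (flat_vol k S) S"
proof -
  have eq: "measure (\<Pi>\<^sub>M i\<in>{..<k}. lborel)
      {x \<in> space (\<Pi>\<^sub>M i\<in>{..<k}. lborel). a + (\<Sum>i<k. x i *\<^sub>R b i) \<in> S} = measure (flat_vol k S) S"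
    if ab: "orthonormal_frame k S a b" for a b
    unfolding flat_vol_eq[OF ab] unfolding flat_measure_def
    by (subst measure_distr) (auto simp: coord_measure_def combine_def intro!: arg_cong2[where f = measure])
  obtain a b where ab: "orthonormal_frame k S a b" using orthonormal_frame_exists[OF assms(1)] .
  show ?thesis
    unfolding vol_def
  proof (rule some_equality)
    show "\<exists>a b. orthonormal_frame k S a b \<and> measure (flat_vol k S) S
      = measure (\<Pi>\<^sub>M i\<in>{..<k}. lborel)
           {x \<in> space (\<Pi>\<^sub>M i\<in>{..<k}. lborel). a + (\<Sum>i<k. x i *\<^sub>R b i) \<in> S}"
      by (intro exI[of _ a] exI[of _ b] conjI ab eq[OF ab, symmetric])
  qed (use eq in auto)
qed

lemma emeasure_flat_vol_cong:
  assumes k: "aff_dim P = int k" and S: "S \<in> sets borel" "S' \<in> sets borel"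
    and eq: "\<And>x. x \<in> affine hull P \<Longrightarrow> x \<in> S \<longleftrightarrow> x \<in> S'"
  shows "emeasure (flat_vol k P) S = emeasure (flat_vol k P) S'"
proof -
  obtain a b where ab: "orthonormal_frame k P a b" using orthonormal_frame_exists[OF k] .
  have "a + combine k b x \<in> affine hull P" for x using ab by (auto simp: orthonormal_frame_iff)
  then show ?thesis
    using eq by (simp add: flat_vol_eq[OF ab] emeasure_flat_measure S indicator_def)
qed

lemma emeasure_flat_vol_bounded:
  assumes k: "aff_dim P = int k" and "bounded S" and [measurable]: "S \<in> sets borel"
  shows "emeasure (flat_vol k P) S < \<infinity>"
proof -
  obtain a b where ab: "orthonormal_frame k P a b" using orthonormal_frame_exists[OF k] .
  obtain r where r: "S \<subseteq> ball a r" using \<open>bounded S\<close> bounded_subset_ballD by blast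
  have "emeasure (flat_vol k P) S \<le> emeasure (flat_vol k P) (ball a r)"
    using r by (intro emeasure_mono) (auto simp: k)
  also have "\<dots> = emeasure (flat_measure k (0 + a) b) (ball a r)"
    by (simp add: flat_vol_eq[OF ab])
  also have "\<dots> = emeasure (flat_measure k 0 b) {y. y + a \<in> ball a r}"
    by (rule emeasure_flat_measure_shift) simp
  also have "{y. y + a \<in> ball a r} = ball 0 r"
    by (auto simp: dist_norm)
  also have "emeasure (flat_measure k 0 b) (ball 0 r) < \<infinity>"
    using ab emeasure_flat_measure_ball(2)[of k b b] by (simp add: orthonormal_frame_iff)
  finally show ?thesis .
qed

lemma emeasure_flat_vol_slices:
  assumes k: "aff_dim F = int k" and p: "p \<in> affine hull F"
    and hull: "affine hull F = {x \<in> affine hull P. N \<bullet> (x - p) = 0}"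
    and N: "N \<in> directions P" "norm N = 1" and S: "S \<in> sets borel"
  shows "emeasure (flat_vol (Suc k) P) S
    = (\<integral>\<^sup>+s. emeasure (flat_vol k F) {y. y + s *\<^sub>R N \<in> S} \<partial>lborel)"
proof -
  obtain a b where ab: "orthonormal_frame k F a b" using orthonormal_frame_exists[OF k] .
  have ab': "orthonormal_frame (Suc k) P a (b(k := N))"
    by (rule orthonormal_frame_extend[OF ab p hull N])
  have "flat_measure k a (b(k := N)) = flat_measure k a b"
    unfolding flat_measure_def combine_def by (intro distr_cong) auto
  then show ?thesis
    using emeasure_flat_measure_slices[OF S, of k a "b(k := N)"]
    by (simp add: flat_vol_eq[OF ab] flat_vol_eq[OF ab'])
qed

text \<open>Slicing in the direction of \<open>M\<close>: all slices but one are empty within the flat.\<close>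

lemma emeasure_flat_vol_hyperplane:
  assumes k: "aff_dim P = int (Suc k)" and M: "M \<in> directions P" "M \<noteq> 0"
  shows "emeasure (flat_vol (Suc k) P) {x. M \<bullet> x = c} = 0"
proof -
  define N where "N = M /\<^sub>R norm M"
  have "P \<noteq> {}" using k by auto
  then obtain p where p: "p \<in> affine hull P" using hull_inc by fast
  have N: "N \<in> directions P" "norm N = 1"
    using M subspace_scale[OF subspace_directions[OF \<open>P \<noteq> {}\<close>]] by (auto simp: N_def)
  define F where "F = {x \<in> affine hull P. N \<bullet> (x - p) = 0}"
  have "N \<noteq> 0" using N(2) by auto
  have F: "aff_dim F = int k" "affine F"
    unfolding F_def using aff_dim_hyperplane_section[OF N(1) \<open>N \<noteq> 0\<close> p] k by auto
  have H: "affine hull F = F" using F(2) by (simp add: affine_hull_eq)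
  have pF: "p \<in> affine hull F" unfolding H using p by (simp add: F_def)
  have hull: "affine hull F = {x \<in> affine hull P. N \<bullet> (x - p) = 0}" unfolding H by (simp add: F_def)
  have MN: "M = norm M *\<^sub>R N" using M(2) by (simp add: N_def)
  have nM: "M \<bullet> (y + s *\<^sub>R N) = norm M * (N \<bullet> p + s)" if "y \<in> affine hull F" for y s
  proof -
    have "N \<bullet> y = N \<bullet> p" using that hull by (auto simp: inner_diff_right)
    moreover have "M \<bullet> (y + s *\<^sub>R N) = norm M * (N \<bullet> y + s * (N \<bullet> N))"
      by (subst MN) (simp add: inner_add_right algebra_simps)
    ultimately show ?thesis using N(2) by (simp add: norm_eq_1)
  qed
  have cl: "{x. M \<bullet> x = c} \<in> sets borel" by (intro borel_closed closed_hyperplane)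
  have cl': "{y. y + s *\<^sub>R N \<in> {x. M \<bullet> x = c}} \<in> sets borel" for s
  proof -
    have "{y. y + s *\<^sub>R N \<in> {x. M \<bullet> x = c}} = {y. M \<bullet> y = c - M \<bullet> (s *\<^sub>R N)}"
      by (auto simp: inner_add_right)
    then show ?thesis by (metis borel_closed closed_hyperplane)
  qed
  have "emeasure (flat_vol (Suc k) P) {x. M \<bullet> x = c}
      = (\<integral>\<^sup>+s. emeasure (flat_vol k F) {y. y + s *\<^sub>R N \<in> {x. M \<bullet> x = c}} \<partial>lborel)"
    by (rule emeasure_flat_vol_slices[OF F(1) pF hull N cl])
  also have "\<dots> = (\<integral>\<^sup>+s. (0::ennreal) \<partial>(lborel :: real measure))"
  proof (rule nn_integral_cong_AE)
    have "emeasure (flat_vol k F) {y. y + s *\<^sub>R N \<in> {x. M \<bullet> x = c}} = 0"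
      if s: "s \<noteq> c / norm M - N \<bullet> p" for s
    proof -
      have "norm M * (N \<bullet> p + s) \<noteq> c" using s M(2) by (auto simp: field_simps)
      then have "emeasure (flat_vol k F) {y. y + s *\<^sub>R N \<in> {x. M \<bullet> x = c}} = emeasure (flat_vol k F) {}"
        using nM by (intro emeasure_flat_vol_cong[OF F(1) cl']) auto
      then show ?thesis by simp
    qed
    moreover have "AE s in lborel. s \<noteq> c / norm M - N \<bullet> p" by (rule AE_lborel_singleton)
    ultimately show "AE s in lborel. emeasure (flat_vol k F) {y. y + s *\<^sub>R N \<in> {x. M \<bullet> x = c}} = 0"
      by (auto elim: eventually_mono)
  qed
  finally show ?thesis by simp
qed

lemma flat_vol_full:
  assumes "affine hull P = (UNIV :: 'a::euclidean_space set)"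
  shows "flat_vol DIM('a) P = lborel"
proof -
  let ?d = "DIM('a)"
  obtain e where e: "bij_betw e {..<?d} (Basis :: 'a set)"
    using ex_bij_betw_nat_finite[of "Basis :: 'a set"] by (auto simp: atLeast0LessThan)
  have eB: "e i \<in> Basis" if "i < ?d" for i using e that bij_betwE by blast
  have inj: "e i = e j \<longleftrightarrow> i = j" if "i < ?d" "j < ?d" for i j
    using e that by (auto simp: bij_betw_def inj_on_def)
  have ax: "orthonormal_axes ?d e"
    unfolding orthonormal_axes_def using eB inj by (auto simp: inner_Basis)
  have "range (\<lambda>x. 0 + combine ?d e x) = UNIV"
  proof -
    have "v = 0 + combine ?d e (\<lambda>i. v \<bullet> e i)" for v
    proof -
      have "v = (\<Sum>b\<in>Basis. (v \<bullet> b) *\<^sub>R b)" by (rule euclidean_representation[symmetric])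
      also have "\<dots> = (\<Sum>i<?d. (v \<bullet> e i) *\<^sub>R e i)"
        by (rule sum.reindex_bij_betw[OF e, symmetric])
      finally show ?thesis by (simp add: combine_def)
    qed
    then show ?thesis by blast
  qed
  then have fr: "orthonormal_frame ?d P 0 e" using ax assms by (simp add: orthonormal_frame_iff)
  have "lborel = flat_measure ?d 0 e"
  proof (rule lborel_eqI)
    fix l u :: 'a assume lu: "\<And>b. b \<in> Basis \<Longrightarrow> l \<bullet> b \<le> u \<bullet> b"
    have mem: "combine ?d e x \<in> box l u \<longleftrightarrow> (\<forall>i<?d. l \<bullet> e i < x i \<and> x i < u \<bullet> e i)" for x
    proof -
      have "combine ?d e x \<in> box l u \<longleftrightarrow> (\<forall>b\<in>e ` {..<?d}. l \<bullet> b < combine ?d e x \<bullet> b \<and> combine ?d e x \<bullet> b < u \<bullet> b)"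
        using e by (auto simp: mem_box bij_betw_def)
      then show ?thesis using combine_inner_axis[OF ax] by auto
    qed
    have "emeasure (flat_measure ?d 0 e) (box l u)
      = emeasure (coord_measure ?d) ((\<lambda>x. 0 + combine ?d e x) -` box l u \<inter> space (coord_measure ?d))"
      unfolding flat_measure_def by (rule emeasure_distr) auto
    also have "(\<lambda>x. 0 + combine ?d e x) -` box l u \<inter> space (coord_measure ?d)
       = Pi\<^sub>E {..<?d} (\<lambda>i. {l \<bullet> e i <..< u \<bullet> e i})"
      using mem by (auto simp: coord_measure_def space_PiM PiE_def Pi_def)
    also have "emeasure (coord_measure ?d) \<dots> = (\<Prod>i<?d. emeasure lborel {l \<bullet> e i <..< u \<bullet> e i})"
      unfolding coord_measure_def by (rule coord.emeasure_PiM) auto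
    also have "\<dots> = (\<Prod>i<?d. ennreal ((u - l) \<bullet> e i))"
      using lu eB by (intro prod.cong) (auto simp: inner_diff_left)
    also have "\<dots> = (\<Prod>b\<in>Basis. ennreal ((u - l) \<bullet> b))"
      by (rule prod.reindex_bij_betw[OF e])
    also have "\<dots> = ennreal (\<Prod>b\<in>Basis. (u - l) \<bullet> b)"
      using lu by (intro prod_ennreal) (auto simp: inner_diff_left)
    finally show "emeasure (flat_measure ?d 0 e) (box l u) = ennreal (\<Prod>b\<in>Basis. (u - l) \<bullet> b)" .
  qed simp
  then show ?thesis by (simp add: flat_vol_eq[OF fr])
qed

section \<open>Facets, inner normals and signed distances\<close>

definition facet_normal :: "'a::euclidean_space set \<Rightarrow> 'a set \<Rightarrow> 'a" where
  "facet_normal P F = (SOME N. inner_unit_normal P F N)"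

text \<open>The signed distance to the hyperplane of the facet inside the affine hull of \<open>P\<close>, positive on the side
of \<open>P\<close>; the base point chosen in \<open>F\<close> is immaterial.\<close>

definition facet_dist :: "'a::euclidean_space set \<Rightarrow> 'a set \<Rightarrow> 'a \<Rightarrow> real" where
  "facet_dist P F x = facet_normal P F \<bullet> (x - (SOME y. y \<in> F))"

lemma inner_unit_normal_iff:
  "inner_unit_normal P F N \<longleftrightarrow> norm N = 1 \<and> N \<in> directions P \<and>
     (\<forall>x\<in>F. \<forall>y\<in>F. N \<bullet> (y - x) = 0) \<and> (\<forall>x\<in>F. \<forall>y\<in>P. N \<bullet> (y - x) \<ge> 0)"
  by (auto simp: inner_unit_normal_def directions_def)

lemma facet_of_nonempty: "F facet_of P \<Longrightarrow> F \<noteq> {}"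
  by (simp add: facet_of_def)

lemma facet_polytope: "polytope P \<Longrightarrow> F facet_of P \<Longrightarrow> polytope F"
  using face_of_polytope_polytope facet_of_imp_face_of by blast

text \<open>A supporting functional of \<open>P\<close> that cuts out \<open>F\<close>, projected to the direction space of \<open>P\<close> and normalised.\<close>

lemma inner_unit_normal_exists:
  assumes P: "polyhedron P" and F: "F facet_of P"
  shows "\<exists>N. inner_unit_normal P F N"
proof -
  obtain a b where ab: "P \<subseteq> {x. a \<bullet> x \<le> b}" "F = P \<inter> {x. a \<bullet> x = b}"
    using facet_of_polyhedron[OF P F] by metis
  obtain q where q: "q \<in> F" using facet_of_nonempty[OF F] by auto
  then have qP: "q \<in> P" using ab by auto
  have "F \<noteq> P" using F by auto
  then obtain p where p: "p \<in> P" "p \<notin> F" using ab(2) by blast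
  have sub: "subspace (directions P)" using qP by (intro subspace_directions) auto
  obtain u z where u: "u \<in> span (directions P)" and z: "\<And>w. w \<in> span (directions P) \<Longrightarrow> orthogonal z w"
    and a: "a = u + z"
    using orthogonal_subspace_decomp_exists[of "directions P" a] by metis
  have span: "span (directions P) = directions P" using sub by (simp add: span_eq_iff)
  have au: "a \<bullet> (x - y) = u \<bullet> (x - y)" if "x \<in> P" "y \<in> P" for x y
  proof -
    have "z \<bullet> (x - y) = 0"
      using z[of "x - y"] that span diff_in_directions[of x P y] hull_subset[of P affine]
      by (auto simp: orthogonal_def)
    then show ?thesis by (simp add: a inner_add_left)
  qed
  have "a \<bullet> (p - q) < 0" using p q ab by (auto simp: inner_diff_right less_le)
  then have "u \<noteq> 0" using au[OF p(1) qP] by auto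
  let ?N = "(- 1 / norm u) *\<^sub>R u"
  have "inner_unit_normal P F ?N"
    unfolding inner_unit_normal_iff
  proof (intro conjI ballI)
    show "norm ?N = 1" using \<open>u \<noteq> 0\<close> by simp
    show "?N \<in> directions P" using u span subspace_scale[OF sub] by blast
  next
    fix x y assume "x \<in> F" "y \<in> F"
    then have "u \<bullet> (y - x) = 0" using ab(2) au[of y x] by (auto simp: inner_diff_right)
    then show "?N \<bullet> (y - x) = 0" by simp
  next
    fix x y assume "x \<in> F" "y \<in> P"
    then have "u \<bullet> (y - x) \<le> 0" using ab au[of y x] by (auto simp: inner_diff_right)
    then show "?N \<bullet> (y - x) \<ge> 0" by (simp add: divide_le_0_iff mult_nonneg_nonpos)
  qed
  then show ?thesis ..
qed

lemma facet_affine_hull: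
  assumes F: "F facet_of P" and N: "inner_unit_normal P F N" and p: "p \<in> F"
  shows "affine hull F = {x \<in> affine hull P. N \<bullet> (x - p) = 0}"
proof -
  let ?H = "{x \<in> affine hull P. N \<bullet> (x - p) = 0}"
  have FP: "F \<subseteq> P" using F by (rule facet_of_imp_subset)
  have N': "N \<in> directions P" "N \<noteq> 0" using N by (auto simp: inner_unit_normal_iff)
  have pP: "p \<in> affine hull P" using p FP by (meson hull_inc subsetD)
  have dim: "aff_dim ?H = aff_dim P - 1" and aff: "affine ?H"
    using aff_dim_hyperplane_section[OF N' pP] .
  have "F \<subseteq> ?H"
    using N p FP hull_subset[of P affine] unfolding inner_unit_normal_iff by blast
  then have "affine hull F \<subseteq> ?H" using aff by (intro hull_minimal) auto
  then show ?thesis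
    using dim aff F by (intro affine_dim_equal) (auto simp: facet_of_def aff_dim_affine_hull)
qed

text \<open>The component of \<open>N'\<close> orthogonal to \<open>N\<close> is parallel to \<open>F\<close>, and so is orthogonal to \<open>N'\<close> as well: it
vanishes.  The sign is determined because \<open>P\<close> does not lie in the hyperplane of \<open>F\<close>.\<close>

lemma inner_unit_normal_unique:
  assumes P: "convex P" and F: "F facet_of P"
    and N: "inner_unit_normal P F N" and N': "inner_unit_normal P F N'"
  shows "N' = N"
proof -
  obtain p where p: "p \<in> F" using facet_of_nonempty[OF F] by auto
  have pP: "p \<in> P" using p F facet_of_imp_subset by blast
  then have pA: "p \<in> affine hull P" by (rule hull_inc)
  have sub: "subspace (directions P)" using pP by (intro subspace_directions) auto
  have n: "norm N = 1" "norm N' = 1" "N \<in> directions P" "N' \<in> directions P"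
    using N N' by (auto simp: inner_unit_normal_iff)
  define c where "c = N \<bullet> N'"
  define w where "w = N' - c *\<^sub>R N"
  have wN: "N \<bullet> w = 0" using n by (simp add: w_def c_def inner_diff_right norm_eq_1)
  have "w \<in> directions P" unfolding w_def using n sub by (intro subspace_diff subspace_scale)
  then have "p + w \<in> affine hull P" using directions_iff[OF pA] by simp
  then have "p + w \<in> affine hull F" using facet_affine_hull[OF F N p] wN by simp
  then have "N' \<bullet> w = 0" using facet_affine_hull[OF F N' p] by simp
  moreover have "w \<bullet> w = N' \<bullet> w - c * (N \<bullet> w)" unfolding w_def by (simp add: inner_diff_left)
  ultimately have "w = 0" using wN by simp
  then have eq: "N' = c *\<^sub>R N" by (simp add: w_def)
  then have "\<bar>c\<bar> = 1" using n by simp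
  moreover have "c \<ge> 0"
  proof (rule ccontr)
    assume "\<not> c \<ge> 0"
    have "P \<subseteq> affine hull F"
    proof
      fix q assume q: "q \<in> P"
      have "N \<bullet> (q - p) \<ge> 0" "N' \<bullet> (q - p) \<ge> 0"
        using N N' p q by (auto simp: inner_unit_normal_iff)
      then have "N \<bullet> (q - p) = 0" using \<open>\<not> c \<ge> 0\<close> by (auto simp: eq zero_le_mult_iff)
      then show "q \<in> affine hull F" using facet_affine_hull[OF F N p] q by (simp add: hull_inc)
    qed
    then have "aff_dim P \<le> aff_dim F" by (metis aff_dim_affine_hull aff_dim_subset)
    then show False using F by (simp add: facet_of_def)
  qed
  ultimately show ?thesis using eq by simp
qed

lemma facet_normal:
  assumes "polytope P" "F facet_of P"
  shows "inner_unit_normal P F (facet_normal P F)"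
  unfolding facet_normal_def
  using inner_unit_normal_exists[OF polytope_imp_polyhedron[OF assms(1)] assms(2)] by (rule someI_ex)

lemma facet_normal_props:
  assumes "polytope P" "F facet_of P"
  shows "norm (facet_normal P F) = 1" "facet_normal P F \<in> directions P"
  using facet_normal[OF assms] by (auto simp: inner_unit_normal_iff)

lemma facet_normal_eqI:
  assumes "polytope P" "F facet_of P" "inner_unit_normal P F N"
  shows "facet_normal P F = N"
  using inner_unit_normal_unique[OF polytope_imp_convex] facet_normal assms by blast

lemma facet_dist_add: "facet_dist P F (x + v) = facet_dist P F x + facet_normal P F \<bullet> v"
  by (simp add: facet_dist_def inner_diff_right inner_add_right)

lemma facet_dist_diff: "facet_dist P F x - facet_dist P F y = facet_normal P F \<bullet> (x - y)"
  by (simp add: facet_dist_def inner_diff_right)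

lemma facet_dist_minus: "facet_dist P F (x - v) = facet_dist P F x - facet_normal P F \<bullet> v"
  by (simp add: facet_dist_def inner_diff_right)

lemma facet_dist_hull:
  assumes P: "polytope P" and F: "F facet_of P"
  shows "affine hull F = {x \<in> affine hull P. facet_dist P F x = 0}"
  using facet_affine_hull[OF F facet_normal[OF P F], of "SOME y. y \<in> F"]
    facet_of_nonempty[OF F] by (simp add: facet_dist_def some_in_eq)

lemma facet_dist_zero:
  assumes "polytope P" "F facet_of P" "x \<in> F"
  shows "facet_dist P F x = 0"
  using facet_dist_hull[OF assms(1,2)] hull_inc[of x F affine] assms(3) by auto

lemma facet_dist_nonneg:
  assumes P: "polytope P" and F: "F facet_of P" and "x \<in> P"
  shows "facet_dist P F x \<ge> 0"
  using facet_normal[OF P F] facet_of_nonempty[OF F] assms(3)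
  by (simp add: facet_dist_def inner_unit_normal_iff some_in_eq)

lemma facet_dist_pos:
  assumes P: "polytope P" and F: "F facet_of P" and x: "x \<in> P" "x \<notin> F"
  shows "facet_dist P F x > 0"
proof -
  have "F = affine hull F \<inter> P"
    using face_of_imp_eq_affine_Int[OF polytope_imp_convex[OF P] facet_of_imp_face_of[OF F]] .
  then have "x \<notin> affine hull F" using x by blast
  then have "facet_dist P F x \<noteq> 0" using facet_dist_hull[OF P F] x(1) by (auto simp: hull_inc)
  then show ?thesis using facet_dist_nonneg[OF P F x(1)] by simp
qed

lemma ray_hits_facet:
  assumes P: "polytope P" and p: "p \<in> rel_interior P" and x: "x \<in> affine hull P" "x \<notin> rel_interior P"
  obtains F d where "F facet_of P" "0 < d" "d \<le> 1" "p + d *\<^sub>R (x - p) \<in> F"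
proof -
  have "x \<noteq> p" using p x by auto
  have "p + (x - p) \<in> affine hull P" using x by simp
  then obtain d where d: "0 < d" "p + d *\<^sub>R (x - p) \<in> rel_frontier P"
      "\<And>e. 0 \<le> e \<Longrightarrow> e < d \<Longrightarrow> p + e *\<^sub>R (x - p) \<in> rel_interior P"
    using ray_to_rel_frontier[OF polytope_imp_bounded[OF P] p, of "x - p"] \<open>x \<noteq> p\<close> by auto
  have "d \<le> 1" using d(3)[of 1] x(2) by force
  then show thesis
    using that d rel_frontier_of_polyhedron[OF polytope_imp_polyhedron[OF P]] by auto
qed

lemma rel_interior_facet_dist_pos:
  assumes P: "polytope P" and F: "F facet_of P" and p: "p \<in> rel_interior P"
  shows "facet_dist P F p > 0"
proof -
  have "F \<inter> rel_interior P = {}"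
    using F by (intro face_of_disjoint_rel_interior) (auto simp: facet_of_imp_face_of)
  then show ?thesis using facet_dist_pos[OF P F] p rel_interior_subset by blast
qed

lemma polytope_rel_interior_nonempty:
  fixes P :: "'a::euclidean_space set"
  assumes "polytope P" "P \<noteq> {}"
  obtains p where "p \<in> rel_interior P"
  using that rel_interior_eq_empty[OF polytope_imp_convex[OF assms(1)]] assms(2) by auto

text \<open>A point of the flat outside \<open>P\<close> is separated from \<open>P\<close> by the facet through which the segment from an
interior point leaves \<open>P\<close>.\<close>

lemma polytope_mem_iff:
  assumes P: "polytope P"
  shows "x \<in> P \<longleftrightarrow> x \<in> affine hull P \<and> (\<forall>F. F facet_of P \<longrightarrow> facet_dist P F x \<ge> 0)"
proof
  assume "x \<in> P"
  then show "x \<in> affine hull P \<and> (\<forall>F. F facet_of P \<longrightarrow> facet_dist P F x \<ge> 0)"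
    using facet_dist_nonneg[OF P] by (auto simp: hull_inc)
next
  assume x: "x \<in> affine hull P \<and> (\<forall>F. F facet_of P \<longrightarrow> facet_dist P F x \<ge> 0)"
  show "x \<in> P"
  proof (rule ccontr)
    assume "x \<notin> P"
    then have "P \<noteq> {}" using x by auto
    then obtain p where p: "p \<in> rel_interior P" using polytope_rel_interior_nonempty[OF P] by metis
    have "x \<notin> rel_interior P" using \<open>x \<notin> P\<close> rel_interior_subset by blast
    then obtain F d where F: "F facet_of P" and d: "0 < d" "d \<le> 1" "p + d *\<^sub>R (x - p) \<in> F"
      using ray_hits_facet[OF P p] x by metis
    let ?n = "facet_normal P F \<bullet> (x - p)"
    have 1: "facet_dist P F p + d * ?n = 0"
      using facet_dist_zero[OF P F d(3)] by (simp add: facet_dist_add)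
    have 2: "facet_dist P F p > 0" by (rule rel_interior_facet_dist_pos[OF P F p])
    have 3: "facet_dist P F x = facet_dist P F p + ?n" using facet_dist_diff[of P F x p] by simp
    have "d \<noteq> 1"
    proof
      assume "d = 1"
      then have "x \<in> F" using d(3) by simp
      then show False using \<open>x \<notin> P\<close> F facet_of_imp_subset by blast
    qed
    then have "d < 1" using d by simp
    moreover have "?n < 0" using 1 2 d(1) by (smt (verit) mult_nonneg_nonneg)
    ultimately have "d * ?n > ?n" by (simp add: mult_less_cancel_right1)
    then show False using 1 3 x F by force
  qed
qed

section \<open>Ridges and dihedral angles\<close>

lemma facets_incomparable:
  assumes P: "polytope P" and F: "F facet_of P" and G: "G facet_of P" and ne: "F \<noteq> G"
  shows "\<not> F \<subseteq> G"
proof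
  assume "F \<subseteq> G"
  then have "F face_of G"
    using face_of_subset[OF facet_of_imp_face_of[OF F]] facet_of_imp_subset[OF G] by blast
  then have "aff_dim F < aff_dim G"
    using face_of_aff_dim_lt polytope_imp_convex[OF facet_polytope[OF P G]] ne by blast
  then show False using F G by (simp add: facet_of_def)
qed

lemma adjacent_facets_sym: "adjacent_facets P F G \<Longrightarrow> adjacent_facets P G F"
  unfolding adjacent_facets_def Int_commute[of F G] by auto

lemma ridge_facet_of:
  assumes "adjacent_facets P F G" "F \<inter> G \<noteq> {}"
  shows "F \<inter> G facet_of F"
proof -
  have "F \<inter> G face_of F"
    using assms face_of_subset[of "F \<inter> G" P F]
    by (auto simp: adjacent_facets_def facet_of_imp_subset)
  then show ?thesis using assms by (auto simp: facet_of_def adjacent_facets_def)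
qed

text \<open>A facet \<open>R\<close> of \<open>F\<close> is a face of \<open>P\<close>, hence the intersection of the facets of \<open>P\<close> containing it.  Any
such facet \<open>G\<close> that does not contain \<open>F\<close> cuts \<open>F\<close> in a proper face containing \<open>R\<close>, and by dimension
this face is \<open>R\<close>.\<close>

lemma facet_of_facet_is_ridge:
  assumes P: "polytope P" and F: "F facet_of P" and R: "R facet_of F"
  obtains G where "adjacent_facets P F G" "R = F \<inter> G"
proof -
  have FP: "F face_of P" "F \<subseteq> P" using facet_of_imp_face_of[OF F] facet_of_imp_subset[OF F] by auto
  have RF: "R face_of F" "R \<subseteq> F" using facet_of_imp_face_of[OF R] facet_of_imp_subset[OF R] by auto
  have RP: "R face_of P" by (rule face_of_trans[OF RF(1) FP(1)])
  have dims: "aff_dim R = aff_dim F - 1" "aff_dim F = aff_dim P - 1"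
    using F R by (auto simp: facet_of_def)
  have "R \<noteq> P" using dims by auto
  then have "R = \<Inter>{G. G facet_of P \<and> R \<subseteq> G}"
    using face_of_polyhedron[OF polytope_imp_polyhedron[OF P] RP] facet_of_nonempty[OF R] by simp
  moreover have "\<not> F \<subseteq> R" using RF R by auto
  ultimately obtain G where G: "G facet_of P" "R \<subseteq> G" "\<not> F \<subseteq> G"
    by (smt (verit, del_insts) Inf_greatest mem_Collect_eq)
  have FG: "F \<inter> G face_of P" by (rule face_of_Int[OF FP(1) facet_of_imp_face_of[OF G(1)]])
  have FGF: "F \<inter> G face_of F" by (rule face_of_subset[OF FG Int_lower1 FP(2)])
  have "F \<inter> G \<noteq> F" using G(3) by blast
  then have lt: "aff_dim (F \<inter> G) < aff_dim F"
    by (rule face_of_aff_dim_lt[OF polytope_imp_convex[OF facet_polytope[OF P F]] FGF])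
  have eq: "R = F \<inter> G"
  proof (rule ccontr)
    assume "R \<noteq> F \<inter> G"
    moreover have "R face_of F \<inter> G"
      using G(2) RF(2) FP(2) by (intro face_of_subset[OF RP]) auto
    moreover have "convex (F \<inter> G)"
      by (rule face_of_imp_convex[OF FG])
    ultimately have "aff_dim R < aff_dim (F \<inter> G)" by (intro face_of_aff_dim_lt)
    then show False using lt dims by simp
  qed
  have "adjacent_facets P F G"
    unfolding adjacent_facets_def using F G(1,3) FG dims by (auto simp flip: eq)
  then show thesis using that eq by blast
qed

text \<open>Excluding the empty ridge makes the
condition on normals vacuous for a segment, so that dimension 1 needs no special treatment in the inductions.\<close>

definition ridge_angle :: "'a::euclidean_space set \<Rightarrow> real \<Rightarrow> bool" where
  "ridge_angle P \<alpha> \<longleftrightarrow> 0 < \<alpha> \<and> \<alpha> < pi \<and>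
     (\<forall>F G. adjacent_facets P F G \<and> F \<inter> G \<noteq> {} \<longrightarrow> facet_normal P F \<bullet> facet_normal P G = cos \<alpha>)"

lemma directions_facet_iff:
  assumes P: "polytope P" and F: "F facet_of P"
  shows "u \<in> directions F \<longleftrightarrow> u \<in> directions P \<and> facet_normal P F \<bullet> u = 0"
proof -
  obtain p where p: "p \<in> F" using facet_of_nonempty[OF F] by auto
  have pF: "p \<in> affine hull F" using p by (rule hull_inc)
  have pP: "p \<in> affine hull P" using p facet_of_imp_subset[OF F] by (auto intro: hull_inc)
  show ?thesis
    using directions_iff[OF pF] directions_iff[OF pP] facet_dist_hull[OF P F]
      facet_dist_zero[OF P F p] by (auto simp: facet_dist_add)
qed

text \<open>In the plane orthogonal to the ridge, the normal of \<open>F \<inter> G\<close> inside \<open>F\<close> is the normalised component of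
\<open>N\<^sub>G\<close> orthogonal to \<open>N\<^sub>F\<close>, which has length \<open>sin \<alpha>\<close> before normalisation.\<close>

lemma ridge_normal:
  assumes P: "polytope P" and \<alpha>: "ridge_angle P \<alpha>" and FG: "adjacent_facets P F G" "F \<inter> G \<noteq> {}"
  shows "facet_normal F (F \<inter> G) = (1 / sin \<alpha>) *\<^sub>R (facet_normal P G - cos \<alpha> *\<^sub>R facet_normal P F)"
      (is "_ = ?n")
    and "x \<in> affine hull F \<Longrightarrow> facet_dist F (F \<inter> G) x = facet_dist P G x / sin \<alpha>"
proof -
  let ?R = "F \<inter> G"
  let ?F = "facet_normal P F" and ?G = "facet_normal P G"
  have F: "F facet_of P" and G: "G facet_of P" using FG(1) by (auto simp: adjacent_facets_def)
  have R: "?R facet_of F" by (rule ridge_facet_of[OF FG])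
  have pF: "polytope F" by (rule facet_polytope[OF P F])
  have s: "sin \<alpha> > 0" using \<alpha> by (intro sin_gt_zero) (auto simp: ridge_angle_def)
  have c: "?F \<bullet> ?G = cos \<alpha>" using \<alpha> FG by (auto simp: ridge_angle_def)
  have nF: "norm ?F = 1" "?F \<in> directions P" "norm ?G = 1" "?G \<in> directions P"
    using facet_normal_props[OF P F] facet_normal_props[OF P G] by auto
  have sub: "subspace (directions P)"
    using facet_of_nonempty[OF F] facet_of_imp_subset[OF F] by (intro subspace_directions) auto
  have nP: "?n \<in> directions P" using nF sub by (intro subspace_scale subspace_diff)
  have Fn: "?F \<bullet> ?n = 0" using c nF by (simp add: inner_diff_right norm_eq_1)
  have nn: "?n \<bullet> v = (?G \<bullet> v) / sin \<alpha>" if "?F \<bullet> v = 0" for v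
    using that by (simp add: inner_diff_left)
  have Fv: "?F \<bullet> (y - x) = 0" if "x \<in> affine hull F" "y \<in> affine hull F" for x y
    using that facet_dist_hull[OF P F] facet_dist_diff[of P F y x] by auto
  have hF: "x \<in> F \<Longrightarrow> x \<in> affine hull F" for x by (rule hull_inc)
  have "?G \<bullet> ?n = (1 - cos \<alpha> ^ 2) / sin \<alpha>"
    using c nF by (simp add: inner_diff_right norm_eq_1 inner_commute power2_eq_square)
  also have "1 - cos \<alpha> ^ 2 = sin \<alpha> * sin \<alpha>" by (simp add: sin_squared_eq flip: power2_eq_square)
  finally have Gn: "?G \<bullet> ?n = sin \<alpha>" using s by simp
  have "?n \<bullet> ?n = 1" unfolding nn[OF Fn] Gn using s by simp
  then have norm: "norm ?n = 1" unfolding norm_eq_1 .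
  have "inner_unit_normal F ?R ?n"
    unfolding inner_unit_normal_iff
  proof (intro conjI ballI norm)
    show "?n \<in> directions F" unfolding directions_facet_iff[OF P F] using nP Fn by (rule conjI)
  next
    fix x y assume xy: "x \<in> ?R" "y \<in> ?R"
    then have "?n \<bullet> (y - x) = (?G \<bullet> (y - x)) / sin \<alpha>" by (intro nn Fv hF) simp_all
    also have "?G \<bullet> (y - x) = 0"
      using xy facet_dist_zero[OF P G] by (simp add: facet_dist_diff[symmetric])
    finally show "?n \<bullet> (y - x) = 0" by simp
  next
    fix x y assume xy: "x \<in> ?R" "y \<in> F"
    then have 1: "?n \<bullet> (y - x) = (?G \<bullet> (y - x)) / sin \<alpha>" by (intro nn Fv hF) simp_all
    have "?G \<bullet> (y - x) \<ge> 0"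
      using xy facet_dist_zero[OF P G] facet_dist_nonneg[OF P G, of y] facet_of_imp_subset[OF F]
      by (auto simp: facet_dist_diff[symmetric])
    then show "?n \<bullet> (y - x) \<ge> 0" unfolding 1 using s by simp
  qed
  then show n: "facet_normal F ?R = ?n" by (rule facet_normal_eqI[OF pF R])
  assume x: "x \<in> affine hull F"
  obtain q where q: "q \<in> ?R" using FG(2) by auto
  have "facet_dist F ?R x = facet_dist F ?R x - facet_dist F ?R q"
    using facet_dist_zero[OF pF R q] by simp
  also have "\<dots> = ?n \<bullet> (x - q)" by (simp only: facet_dist_diff n)
  also have "\<dots> = (?G \<bullet> (x - q)) / sin \<alpha>" using q by (intro nn Fv x hF) simp_all
  also have "?G \<bullet> (x - q) = facet_dist P G x"
    using facet_dist_zero[OF P G, of q] q by (simp add: facet_dist_diff[symmetric])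
  finally show "facet_dist F ?R x = facet_dist P G x / sin \<alpha>" .
qed

section \<open>The cone at a point and the adjacency of its facets\<close>

text \<open>The facets through \<open>v\<close> determine \<open>Q\<close> near \<open>v\<close>: the other ones are at positive distance from \<open>v\<close>.\<close>

lemma scaled_cone_point_mem:
  assumes Q: "polytope Q" and v: "v \<in> Q" and x: "x \<in> affine hull Q"
    and nn: "\<And>R. R facet_of Q \<Longrightarrow> v \<in> R \<Longrightarrow> facet_dist Q R x \<ge> 0"
  shows "\<exists>\<delta>>0. v + \<delta> *\<^sub>R (x - v) \<in> Q"
proof -
  have vQ: "v \<in> affine hull Q" using v by (rule hull_inc)
  have sub: "subspace (directions Q)" using v by (intro subspace_directions) auto
  have "\<forall>\<^sub>F \<delta> in at_right 0. facet_dist Q R (v + \<delta> *\<^sub>R (x - v)) \<ge> 0" if R: "R facet_of Q" for R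
  proof (cases "v \<in> R")
    case True
    have "\<forall>\<^sub>F \<delta>::real in at_right 0. \<delta> > 0" by (simp add: eventually_at_right_less)
    then show ?thesis
    proof eventually_elim
      case (elim \<delta>)
      have "facet_dist Q R (v + \<delta> *\<^sub>R (x - v)) = \<delta> * facet_dist Q R x"
        using facet_dist_zero[OF Q R True] by (simp add: facet_dist_add facet_dist_diff[symmetric])
      then show ?case using elim nn[OF R True] by simp
    qed
  next
    case False
    have "((\<lambda>\<delta>. facet_dist Q R v + \<delta> * (facet_normal Q R \<bullet> (x - v))) \<longlongrightarrow>
        facet_dist Q R v + 0 * (facet_normal Q R \<bullet> (x - v))) (at_right 0)"
      by (intro tendsto_intros)
    then have "\<forall>\<^sub>F \<delta> in at_right 0. facet_dist Q R v + \<delta> * (facet_normal Q R \<bullet> (x - v)) > 0"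
      using facet_dist_pos[OF Q R v False] by (intro order_tendstoD) auto
    then show ?thesis by eventually_elim (simp add: facet_dist_add)
  qed
  then have "\<forall>\<^sub>F \<delta> in at_right 0. \<forall>R\<in>{R. R facet_of Q}. facet_dist Q R (v + \<delta> *\<^sub>R (x - v)) \<ge> 0"
    using finite_polytope_facets[OF Q] by (intro eventually_ball_finite) auto
  moreover have "\<forall>\<^sub>F \<delta>::real in at_right 0. \<delta> > 0" by (simp add: eventually_at_right_less)
  ultimately have "\<forall>\<^sub>F \<delta> in at_right 0. \<delta> > 0 \<and> (\<forall>R\<in>{R. R facet_of Q}. facet_dist Q R (v + \<delta> *\<^sub>R (x - v)) \<ge> 0)"
    by eventually_elim auto
  then obtain \<delta> where \<delta>: "\<delta> > 0" "\<And>R. R facet_of Q \<Longrightarrow> facet_dist Q R (v + \<delta> *\<^sub>R (x - v)) \<ge> 0"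
    using eventually_happens[of _ "at_right (0::real)"] by auto
  have "v + \<delta> *\<^sub>R (x - v) \<in> affine hull Q"
    by (rule directions_iff[OF vQ, THEN iffD1]) (intro subspace_scale[OF sub] diff_in_directions[OF x vQ])
  then have "v + \<delta> *\<^sub>R (x - v) \<in> Q"
    unfolding polytope_mem_iff[OF Q, of "v + \<delta> *\<^sub>R (x - v)"] using \<delta>(2) by simp
  then show ?thesis using \<delta>(1) by (intro exI[of _ \<delta>] conjI)
qed

text \<open>After shrinking towards \<open>v\<close>, a point of the cone of \<open>F\<close> at \<open>v\<close> lies in \<open>F\<close>, hence in \<open>P\<close>; and shrinking
towards \<open>v\<close> does not change the sign of the distance to a facet through \<open>v\<close>.\<close>

lemma facet_cone_subset_cone:
  assumes P: "polytope P" and F: "F facet_of P" and v: "v \<in> F" and x: "x \<in> affine hull F"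
    and nn: "\<And>R. R facet_of F \<Longrightarrow> v \<in> R \<Longrightarrow> facet_dist F R x \<ge> 0"
    and G: "G facet_of P" "v \<in> G"
  shows "facet_dist P G x \<ge> 0"
proof -
  have "\<exists>\<delta>>0. v + \<delta> *\<^sub>R (x - v) \<in> F"
    by (rule scaled_cone_point_mem[OF facet_polytope[OF P F] v x nn])
  then obtain \<delta> where \<delta>: "\<delta> > 0" "v + \<delta> *\<^sub>R (x - v) \<in> F" by blast
  then have "facet_dist P G (v + \<delta> *\<^sub>R (x - v)) \<ge> 0"
    using facet_dist_nonneg[OF P G(1)] facet_of_imp_subset[OF F] by blast
  moreover have "facet_dist P G (v + \<delta> *\<^sub>R (x - v)) = \<delta> * facet_dist P G x"
    using facet_dist_zero[OF P G] by (simp add: facet_dist_add facet_dist_diff[symmetric])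
  ultimately show ?thesis using \<delta>(1) by (simp add: zero_le_mult_iff)
qed

lemma first_zero_along_ray:
  fixes f g :: "'i \<Rightarrow> real"
  assumes "finite A" "\<And>i. i \<in> A \<Longrightarrow> f i > 0" "i0 \<in> A" "g i0 < 0"
  obtains \<tau> i where "\<tau> > 0" "i \<in> A" "f i + \<tau> * g i = 0" "\<And>j. j \<in> A \<Longrightarrow> f j + \<tau> * g j \<ge> 0"
proof -
  let ?B = "{i \<in> A. g i < 0}" and ?h = "\<lambda>i. f i / - g i"
  have "i0 \<in> ?B" using assms(3,4) by simp
  then have B: "finite (?h ` ?B)" "?h ` ?B \<noteq> {}" using assms(1) by (simp, blast)
  define \<tau> where "\<tau> = Min (?h ` ?B)"
  have "\<tau> \<in> ?h ` ?B" unfolding \<tau>_def by (rule Min_in[OF B])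
  then obtain i where i: "i \<in> A" "g i < 0" "\<tau> = f i / - g i" by auto
  have "\<tau> > 0" using i assms(2)[of i] by (simp add: divide_pos_neg)
  moreover have "f i + \<tau> * g i = 0" using i by simp
  moreover have "f j + \<tau> * g j \<ge> 0" if j: "j \<in> A" for j
  proof (cases "g j < 0")
    case True
    then have "\<tau> \<le> f j / - g j" unfolding \<tau>_def using j B(1) by (intro Min_le) auto
    then show ?thesis using True by (simp add: field_simps)
  next
    case False
    then show ?thesis using \<open>\<tau> > 0\<close> assms(2)[OF j] by (smt (verit) mult_nonneg_nonneg)
  qed
  ultimately show thesis using that i(1) by blast
qed

text \<open>Let \<open>Q\<close> be the cone at \<open>v\<close> defined by the facets in \<open>A\<close>; it contains the cone \<open>C\<close> of \<open>P\<close> at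
\<open>v\<close>.  A boundary point of \<open>Q\<close> on the hyperplane of some \<open>i \<in> A\<close> satisfies the constraints of all facets
adjacent to \<open>i\<close>, since these are in \<open>A\<close>; so it lies in the cone of the facet \<open>i\<close>, hence in \<open>C\<close>.  Thus the
boundary of \<open>Q\<close> is contained in the convex set \<open>C\<close>.  As \<open>Q\<close> has two non-parallel facets, through any of
its points there is a line leaving \<open>Q\<close> on both sides, and the point is between two points of \<open>C\<close>.  So
\<open>Q = C\<close>, whereas a facet \<open>J\<close> outside \<open>A\<close> would leave room in \<open>Q - C\<close> just beyond its interior.\<close>

lemma facets_at_point_connected:
  assumes P: "polytope P" and \<alpha>: "ridge_angle P \<alpha>"
    and A: "\<And>F. F \<in> A \<Longrightarrow> F facet_of P \<and> v \<in> F"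
    and closed: "\<And>F G. F \<in> A \<Longrightarrow> adjacent_facets P F G \<Longrightarrow> v \<in> G \<Longrightarrow> G \<in> A"
    and F0: "F0 \<in> A" "adjacent_facets P F0 G0" "v \<in> G0"
    and J: "J facet_of P" "v \<in> J"
  shows "J \<in> A"
proof (rule ccontr)
  assume "J \<notin> A"
  have s: "sin \<alpha> > 0" using \<alpha> by (intro sin_gt_zero) (auto simp: ridge_angle_def)
  have fin: "finite A" using A finite_polytope_facets[OF P] by (metis finite_subset mem_Collect_eq subsetI)
  have pJ: "polytope J" by (rule facet_polytope[OF P J(1)])
  obtain z where z: "z \<in> rel_interior J"
    using polytope_rel_interior_nonempty[OF pJ facet_of_nonempty[OF J(1)]] .
  have zJ: "z \<in> J" "z \<in> P" using z rel_interior_subset facet_of_imp_subset[OF J(1)] by auto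
  have sub: "subspace (directions P)" using zJ by (intro subspace_directions) auto
  have zpos: "facet_dist P i z > 0" if "i \<in> A" for i
  proof (rule facet_dist_pos[OF P])
    show i: "i facet_of P" using A that by blast
    have "i \<noteq> J" using that \<open>J \<notin> A\<close> by auto
    then have "\<not> J \<subseteq> i" using facets_incomparable[OF P J(1) i] by auto
    have "i \<inter> J face_of J"
      using face_of_subset[OF face_of_Int[OF facet_of_imp_face_of[OF i] facet_of_imp_face_of[OF J(1)]], of J]
        facet_of_imp_subset[OF J(1)] by auto
    then have "(i \<inter> J) \<inter> rel_interior J = {}"
      using \<open>\<not> J \<subseteq> i\<close> by (intro face_of_disjoint_rel_interior) auto
    then show "z \<notin> i" using z zJ by blast
  qed (rule zJ)
  let ?J = "facet_normal P J"
  have "\<forall>\<^sub>F \<delta> in at_right 0. facet_dist P i (z - \<delta> *\<^sub>R ?J) > 0" if "i \<in> A" for i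
  proof -
    have "((\<lambda>\<delta>. facet_dist P i z - \<delta> * (facet_normal P i \<bullet> ?J)) \<longlongrightarrow>
        facet_dist P i z - 0 * (facet_normal P i \<bullet> ?J)) (at_right 0)"
      by (intro tendsto_intros)
    then have "\<forall>\<^sub>F \<delta> in at_right 0. facet_dist P i z - \<delta> * (facet_normal P i \<bullet> ?J) > 0"
      using zpos[OF that] by (intro order_tendstoD) auto
    then show ?thesis by eventually_elim (simp add: facet_dist_minus)
  qed
  then have "\<forall>\<^sub>F \<delta> in at_right 0. \<forall>i\<in>A. facet_dist P i (z - \<delta> *\<^sub>R ?J) > 0"
    using fin by (intro eventually_ball_finite) auto
  moreover have "\<forall>\<^sub>F \<delta>::real in at_right 0. \<delta> > 0" by (simp add: eventually_at_right_less)
  ultimately have ev: "\<forall>\<^sub>F \<delta> in at_right 0. \<delta> > 0 \<and> (\<forall>i\<in>A. facet_dist P i (z - \<delta> *\<^sub>R ?J) > 0)"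
    by eventually_elim auto
  from eventually_happens[OF ev] obtain \<delta> where \<delta>: "\<delta> > 0" "\<And>i. i \<in> A \<Longrightarrow> facet_dist P i (z - \<delta> *\<^sub>R ?J) > 0"
    by auto
  \<comment> \<open>a point of \<open>Q\<close> just beyond an interior point of the facet \<open>J\<close>\<close>
  define x where "x = z - \<delta> *\<^sub>R ?J"
  have zh: "z \<in> affine hull P" using zJ(2) by (rule hull_inc)
  have xz: "x = z + (- \<delta>) *\<^sub>R ?J" by (simp add: x_def)
  have xh: "x \<in> affine hull P"
    unfolding xz
    by (rule directions_iff[OF zh, THEN iffD1])
      (intro subspace_scale[OF sub] facet_normal_props(2)[OF P J(1)])
  have xJ: "facet_dist P J x = - \<delta>"
    unfolding xz facet_dist_add using facet_dist_zero[OF P J(1) zJ(1)] facet_normal_props(1)[OF P J(1)]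
    by (simp add: norm_eq_1)
  \<comment> \<open>a ray from \<open>x\<close> that leaves \<open>Q\<close> does so in the cone of \<open>P\<close> at \<open>v\<close>, on the inner side of \<open>J\<close>\<close>
  have exit: "\<exists>\<tau>>0. facet_dist P J x + \<tau> * (?J \<bullet> u) \<ge> 0"
    if u: "u \<in> directions P" and i0: "i0 \<in> A" "facet_normal P i0 \<bullet> u < 0" for u i0
  proof -
    obtain \<tau> i where \<tau>: "\<tau> > 0" and i: "i \<in> A" "facet_dist P i x + \<tau> * (facet_normal P i \<bullet> u) = 0"
      and nn: "\<And>j. j \<in> A \<Longrightarrow> facet_dist P j x + \<tau> * (facet_normal P j \<bullet> u) \<ge> 0"
      using first_zero_along_ray[OF fin, of "\<lambda>i. facet_dist P i x" i0 "\<lambda>i. facet_normal P i \<bullet> u"]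
        \<delta>(2) i0 unfolding x_def by metis
    let ?x = "x + \<tau> *\<^sub>R u"
    have xi: "facet_dist P j ?x = facet_dist P j x + \<tau> * (facet_normal P j \<bullet> u)" for j
      by (simp add: facet_dist_add)
    have "?x \<in> affine hull P"
      by (rule directions_iff[OF xh, THEN iffD1]) (rule subspace_scale[OF sub u])
    moreover have iP: "i facet_of P" "v \<in> i" using A i(1) by auto
    ultimately have xhi: "?x \<in> affine hull i" using facet_dist_hull[OF P iP(1)] i(2) xi by auto
    have "facet_dist P J ?x \<ge> 0"
    proof (rule facet_cone_subset_cone[OF P iP xhi _ J])
      fix R assume R: "R facet_of i" "v \<in> R"
      obtain G where G: "adjacent_facets P i G" "R = i \<inter> G"
        using facet_of_facet_is_ridge[OF P iP(1) R(1)] .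
      have "G \<in> A" using closed[OF i(1) G(1)] R(2) G(2) by auto
      then have "facet_dist P G ?x \<ge> 0" using nn xi by simp
      moreover have "facet_dist i R ?x = facet_dist P G ?x / sin \<alpha>"
        unfolding G(2) using R(2) G(2) by (intro ridge_normal(2)[OF P \<alpha> G(1) _ xhi]) auto
      ultimately show "facet_dist i R ?x \<ge> 0" using s by simp
    qed
    then show ?thesis using \<tau> xi by auto
  qed
  have F0P: "F0 facet_of P" and G0P: "G0 facet_of P" and ne: "F0 \<noteq> G0"
    using F0(2) by (auto simp: adjacent_facets_def)
  obtain w where w: "w \<in> F0" "w \<notin> G0" using facets_incomparable[OF P F0P G0P ne] by auto
  obtain y where y: "y \<in> G0" "y \<notin> F0" using facets_incomparable[OF P G0P F0P] ne by auto
  have wyP: "w \<in> P" "y \<in> P" using w y facet_of_imp_subset[OF F0P] facet_of_imp_subset[OF G0P] by auto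
  have G0A: "G0 \<in> A" using closed[OF F0] .
  \<comment> \<open>\<open>?u\<close> decreases the distance to \<open>G0\<close> and increases the distance to \<open>F0\<close>, so the line leaves \<open>Q\<close> at both ends\<close>
  let ?u = "y - w"
  have u: "?u \<in> directions P" "- ?u \<in> directions P"
    using wyP diff_in_directions hull_inc by (metis, metis minus_diff_eq)
  have "facet_normal P G0 \<bullet> ?u < 0"
    using facet_dist_pos[OF P G0P wyP(1) w(2)] facet_dist_zero[OF P G0P y(1)] facet_dist_diff[of P G0 y w] by simp
  then obtain \<tau>1 where \<tau>1: "\<tau>1 > 0" "facet_dist P J x + \<tau>1 * (?J \<bullet> ?u) \<ge> 0"
    using exit[OF u(1) G0A] by auto
  have "facet_normal P F0 \<bullet> - ?u < 0"
    using facet_dist_pos[OF P F0P wyP(2) y(2)] facet_dist_zero[OF P F0P w(1)] facet_dist_diff[of P F0 w y] by simp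
  then obtain \<tau>2 where \<tau>2: "\<tau>2 > 0" "facet_dist P J x + \<tau>2 * (?J \<bullet> - ?u) \<ge> 0"
    using exit[OF u(2) F0(1)] by blast
  have "\<tau>1 * (?J \<bullet> ?u) > 0" "\<tau>2 * (?J \<bullet> - ?u) > 0" using \<tau>1 \<tau>2 xJ \<delta>(1) by linarith+
  then have "?J \<bullet> ?u > 0" "?J \<bullet> - ?u > 0" using \<tau>1(1) \<tau>2(1) by (simp_all add: zero_less_mult_iff)
  then show False by (simp add: inner_diff_right)
qed

section \<open>Corner vectors\<close>

text \<open>The point \<open>v + \<rho> w\<close> is the centre of the ball of radius \<open>\<rho>\<close> that touches the hyperplanes of all the facets
through \<open>v\<close>.\<close>

definition corner :: "'a::euclidean_space set \<Rightarrow> 'a \<Rightarrow> 'a \<Rightarrow> bool" where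
  "corner P v w \<longleftrightarrow> w \<in> directions P \<and>
     (\<forall>F. F facet_of P \<longrightarrow> v \<in> F \<longrightarrow> facet_normal P F \<bullet> w = 1)"

text \<open>The difference \<open>u\<close> of two corner vectors is orthogonal to the normals of all the facets through \<open>v\<close>, so
\<open>P\<close> contains points \<open>v + \<delta> u\<close> and \<open>v - \<epsilon> u\<close>; but \<open>v\<close> is an extreme point.\<close>

lemma corner_unique:
  assumes P: "polytope P" and v: "v extreme_point_of P"
    and w: "corner P v w" and w': "corner P v w'"
  shows "w = w'"
proof (rule ccontr)
  assume "w \<noteq> w'"
  define u where "u = w - w'"
  have "u \<noteq> 0" using \<open>w \<noteq> w'\<close> by (simp add: u_def)
  have vP: "v \<in> P" using v by (simp add: extreme_point_of_def)
  have vh: "v \<in> affine hull P" using vP by (rule hull_inc)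
  have sub: "subspace (directions P)" using vP by (intro subspace_directions) auto
  have uD: "u \<in> directions P" unfolding u_def using w w' sub by (intro subspace_diff) (auto simp: corner_def)
  have step: "\<exists>\<delta>>0. v + \<delta> *\<^sub>R z \<in> P"
    if z: "z \<in> directions P" "\<And>F. F facet_of P \<Longrightarrow> v \<in> F \<Longrightarrow> facet_normal P F \<bullet> z = 0" for z
  proof -
    have "\<exists>\<delta>>0. v + \<delta> *\<^sub>R ((v + z) - v) \<in> P"
    proof (rule scaled_cone_point_mem[OF P vP])
      show "v + z \<in> affine hull P" using directions_iff[OF vh] z(1) by simp
      fix R assume "R facet_of P" "v \<in> R"
      then show "facet_dist P R (v + z) \<ge> 0"
        using z(2) facet_dist_zero[OF P] by (simp add: facet_dist_add)
    qed
    then show ?thesis by simp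
  qed
  have Fu: "facet_normal P F \<bullet> u = 0" if "F facet_of P" "v \<in> F" for F
    using w w' that by (simp add: corner_def u_def inner_diff_right)
  obtain \<delta> where \<delta>: "\<delta> > 0" "v + \<delta> *\<^sub>R u \<in> P" using step[OF uD Fu] by auto
  have "- u \<in> directions P" using subspace_neg[OF sub uD] .
  then obtain \<epsilon> where \<epsilon>: "\<epsilon> > 0" "v + \<epsilon> *\<^sub>R (- u) \<in> P" using step[of "- u"] Fu by auto
  have "v \<in> open_segment (v + \<delta> *\<^sub>R u) (v + \<epsilon> *\<^sub>R (- u))"
    unfolding in_segment
  proof (intro conjI exI[of _ "\<delta> / (\<delta> + \<epsilon>)"])
    have "(\<delta> + \<epsilon>) *\<^sub>R u \<noteq> 0" using \<delta>(1) \<epsilon>(1) \<open>u \<noteq> 0\<close> by simp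
    then show "v + \<delta> *\<^sub>R u \<noteq> v + \<epsilon> *\<^sub>R (- u)" by (auto simp: scaleR_add_left add_eq_0_iff)
    let ?t = "\<delta> / (\<delta> + \<epsilon>)"
    show "0 < ?t" "?t < 1" using \<delta>(1) \<epsilon>(1) by auto
    have "(1 - ?t) *\<^sub>R (v + \<delta> *\<^sub>R u) + ?t *\<^sub>R (v + \<epsilon> *\<^sub>R (- u)) = v + ((1 - ?t) * \<delta> - ?t * \<epsilon>) *\<^sub>R u"
      by (simp add: algebra_simps)
    also have "(1 - ?t) * \<delta> - ?t * \<epsilon> = 0" using \<delta>(1) \<epsilon>(1) by (simp add: field_simps)
    finally show "v = (1 - ?t) *\<^sub>R (v + \<delta> *\<^sub>R u) + ?t *\<^sub>R (v + \<epsilon> *\<^sub>R (- u))" by simp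
  qed
  then show False using v \<delta>(2) \<epsilon>(2) by (auto simp: extreme_point_of_def)
qed

lemma tan_half_angle:
  fixes x :: real
  assumes "0 < x" "x < pi"
  shows "tan (x / 2) > 0" "tan (x / 2) * (1 + cos x) = sin x" "tan (x / 2) * sin x = 1 - cos x"
proof -
  have s: "sin x > 0" using assms by (rule sin_gt_zero)
  have c: "1 + cos x > 0"
    using cos_monotone_0_pi[of x pi] assms by simp
  have t: "tan (x / 2) = sin x / (cos x + 1)"
    using tan_half[of "x / 2"] by simp
  show "tan (x / 2) > 0" using s c by (simp add: t)
  show *: "tan (x / 2) * (1 + cos x) = sin x" using c by (simp add: t add.commute)
  have "sin x * (1 + cos x) * tan (x / 2) = sin x ^ 2"
    using * by (simp add: power2_eq_square mult.assoc mult.commute)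
  also have "\<dots> = (1 - cos x) * (1 + cos x)" by (simp add: sin_squared_eq algebra_simps power2_eq_square)
  finally show "tan (x / 2) * sin x = 1 - cos x" using c by (simp add: mult.assoc mult.commute)
qed

text \<open>The ball of centre \<open>v + U\<close> and radius 1 touches the hyperplane of \<open>F\<close> at \<open>v + U - N\<^sub>F\<close>.  In the plane
orthogonal to a ridge of \<open>F\<close> through \<open>v\<close> one sees a circle inscribed in a wedge of outer angle \<open>\<alpha>\<close>, so this
point of contact has distance \<open>tan (\<alpha> / 2)\<close> from each of these ridges.\<close>

lemma corner_of_facet:
  assumes P: "polytope P" and \<alpha>: "ridge_angle P \<alpha>" and F: "F facet_of P" and v: "v \<in> F"
    and U: "corner P v U"
  obtains w where "corner F v w" "U = facet_normal P F + tan (\<alpha> / 2) *\<^sub>R w"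
proof
  let ?N = "facet_normal P F" and ?t = "tan (\<alpha> / 2)"
  have a: "0 < \<alpha>" "\<alpha> < pi" using \<alpha> by (auto simp: ridge_angle_def)
  have t: "?t > 0" by (rule tan_half_angle(1)[OF a])
  have s: "sin \<alpha> > 0" using a by (rule sin_gt_zero)
  have sub: "subspace (directions P)"
    using facet_of_nonempty[OF F] facet_of_imp_subset[OF F] by (intro subspace_directions) auto
  have n: "norm ?N = 1" "?N \<in> directions P" by (rule facet_normal_props[OF P F])+
  have WP: "U \<in> directions P" and NW: "\<And>G. G facet_of P \<Longrightarrow> v \<in> G \<Longrightarrow> facet_normal P G \<bullet> U = 1"
    using U by (auto simp: corner_def)
  let ?w = "(1 / ?t) *\<^sub>R (U - ?N)"
  show "U = ?N + ?t *\<^sub>R ?w" using t by simp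
  have F0: "?N \<bullet> (U - ?N) = 0" using NW[OF F v] n by (simp add: inner_diff_right norm_eq_1)
  show "corner F v ?w"
    unfolding corner_def
  proof (intro conjI allI impI)
    have "?w \<in> directions P" using WP n sub by (intro subspace_scale subspace_diff)
    then show "?w \<in> directions F" unfolding directions_facet_iff[OF P F] using F0 by simp
    fix R assume R: "R facet_of F" "v \<in> R"
    obtain G where G: "adjacent_facets P F G" "R = F \<inter> G" by (rule facet_of_facet_is_ridge[OF P F R(1)])
    have ne: "F \<inter> G \<noteq> {}" and vG: "v \<in> G" using R(2) G(2) by auto
    have GP: "G facet_of P" using G(1) by (auto simp: adjacent_facets_def)
    have NG: "?N \<bullet> facet_normal P G = cos \<alpha>" using \<alpha> G(1) ne by (auto simp: ridge_angle_def)
    have "facet_normal F R \<bullet> ?w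
        = ((facet_normal P G - cos \<alpha> *\<^sub>R ?N) \<bullet> (U - ?N)) / (sin \<alpha> * ?t)"
      unfolding G(2) ridge_normal(1)[OF P \<alpha> G(1) ne] by simp
    also have "(facet_normal P G - cos \<alpha> *\<^sub>R ?N) \<bullet> (U - ?N) = facet_normal P G \<bullet> (U - ?N)"
      using F0 by (simp add: inner_diff_left)
    also have "\<dots> = 1 - cos \<alpha>"
      using NW[OF GP vG] NG by (simp add: inner_diff_right inner_commute)
    also have "\<dots> = sin \<alpha> * ?t" using tan_half_angle(3)[OF a] by (simp add: mult.commute)
    finally show "facet_normal F R \<bullet> ?w = 1" using s t by simp
  qed
qed

text \<open>The dihedral angles of a face depend on its dimension only.  Angles are indexed from 1 on; by
\<open>ridge_angle\<close>, nothing is required of \<open>\<alpha> 1\<close> but to lie in \<open>(0,\<pi>)\<close>.\<close>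

definition flag_angles :: "nat \<Rightarrow> 'a::euclidean_space set \<Rightarrow> (nat \<Rightarrow> real) \<Rightarrow> bool" where
  "flag_angles k P \<alpha> \<longleftrightarrow>
     (\<forall>j<k. \<forall>F. F face_of P \<longrightarrow> aff_dim F = int (Suc j) \<longrightarrow> ridge_angle F (\<alpha> (Suc j)))"

lemma flag_angles_facet:
  assumes "flag_angles (Suc k) P \<alpha>" "F facet_of P"
  shows "flag_angles k F \<alpha>"
  unfolding flag_angles_def
proof (intro allI impI)
  fix j G assume j: "j < k" and G: "G face_of F" "aff_dim G = int (Suc j)"
  have "G face_of P" using face_of_trans[OF G(1) facet_of_imp_face_of[OF assms(2)]] .
  then show "ridge_angle G (\<alpha> (Suc j))" using assms(1) j G(2) by (auto simp: flag_angles_def)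
qed

lemma flag_angles_self:
  assumes "flag_angles (Suc k) P \<alpha>" "polytope P" "aff_dim P = int (Suc k)"
  shows "ridge_angle P (\<alpha> (Suc k))"
  using assms face_of_refl[OF polytope_imp_convex] by (auto simp: flag_angles_def)

lemma facet_aff_dim: "F facet_of P \<Longrightarrow> aff_dim P = int (Suc k) \<Longrightarrow> aff_dim F = int k"
  by (simp add: facet_of_def)

lemma extreme_point_facet:
  "F facet_of P \<Longrightarrow> v extreme_point_of P \<Longrightarrow> v \<in> F \<Longrightarrow> v extreme_point_of F"
  using extreme_point_of_face[OF facet_of_imp_face_of] by blast

text \<open>With \<open>R = F \<inter> G\<close> and \<open>n\<^sub>F\<close>, \<open>n\<^sub>G\<close> its normals inside \<open>F\<close> and \<open>G\<close>, the corner vectors of the two facets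
are \<open>n\<^sub>F + t' w\<^sub>R\<close> and \<open>n\<^sub>G + t' w\<^sub>R\<close>: the same \<open>t'\<close>, because \<open>F\<close> and \<open>G\<close> have the same dimension.  What
remains is \<open>N\<^sub>F + t n\<^sub>F = N\<^sub>G + t n\<^sub>G\<close>, both sides being the vector on the bisector of the wedge with
distance 1 from its two sides.\<close>

lemma corner_adjacent_facets:
  assumes P: "polytope P" and dim: "aff_dim P = int (Suc (Suc k))" and \<alpha>: "flag_angles (Suc (Suc k)) P \<alpha>"
    and v: "v extreme_point_of P" and FG: "adjacent_facets P F G" "v \<in> F" "v \<in> G"
    and wF: "corner F v wF" and wG: "corner G v wG"
  defines "t \<equiv> tan (\<alpha> (Suc (Suc k)) / 2)"
  shows "facet_normal P F + t *\<^sub>R wF = facet_normal P G + t *\<^sub>R wG"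
proof -
  let ?a = "\<alpha> (Suc (Suc k))" and ?R = "F \<inter> G"
  have F: "F facet_of P" and G: "G facet_of P" using FG(1) by (auto simp: adjacent_facets_def)
  have pF: "polytope F" and pG: "polytope G" using facet_polytope[OF P] F G by auto
  have aP: "ridge_angle P ?a" by (rule flag_angles_self[OF \<alpha> P dim])
  have aF: "ridge_angle F (\<alpha> (Suc k))"
    by (rule flag_angles_self[OF flag_angles_facet[OF \<alpha> F] pF facet_aff_dim[OF F dim]])
  have aG: "ridge_angle G (\<alpha> (Suc k))"
    by (rule flag_angles_self[OF flag_angles_facet[OF \<alpha> G] pG facet_aff_dim[OF G dim]])
  have ne: "F \<inter> G \<noteq> {}" "G \<inter> F \<noteq> {}" and vR: "v \<in> ?R" using FG by auto
  have GF: "adjacent_facets P G F" by (rule adjacent_facets_sym[OF FG(1)])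
  have RF: "?R facet_of F" by (rule ridge_facet_of[OF FG(1) ne(1)])
  have RG: "?R facet_of G" using ridge_facet_of[OF GF ne(2)] by (simp add: Int_commute)
  have pR: "polytope ?R" by (rule facet_polytope[OF pF RF])
  have vxR: "v extreme_point_of ?R"
    by (rule extreme_point_facet[OF RF extreme_point_facet[OF F v FG(2)] vR])
  obtain w where w: "corner ?R v w" "wF = facet_normal F ?R + tan (\<alpha> (Suc k) / 2) *\<^sub>R w"
    by (rule corner_of_facet[OF pF aF RF vR wF])
  obtain w' where w': "corner ?R v w'" "wG = facet_normal G ?R + tan (\<alpha> (Suc k) / 2) *\<^sub>R w'"
    by (rule corner_of_facet[OF pG aG RG vR wG])
  have "w = w'" by (rule corner_unique[OF pR vxR w(1) w'(1)])
  then have "wF - wG = facet_normal F ?R - facet_normal G (G \<inter> F)"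
    using w(2) w'(2) by (simp add: Int_commute)
  also have "\<dots> = ((1 + cos ?a) / sin ?a) *\<^sub>R (facet_normal P G - facet_normal P F)"
    unfolding ridge_normal(1)[OF P aP FG(1) ne(1)] ridge_normal(1)[OF P aP GF ne(2)]
    by (simp add: algebra_simps add_divide_distrib)
  finally have d: "wF - wG = ((1 + cos ?a) / sin ?a) *\<^sub>R (facet_normal P G - facet_normal P F)" .
  have a: "0 < ?a" "?a < pi" using aP by (auto simp: ridge_angle_def)
  have "t * ((1 + cos ?a) / sin ?a) = 1"
    using tan_half_angle(2)[OF a] sin_gt_zero[OF a] by (simp add: t_def)
  then have "t *\<^sub>R (wF - wG) = facet_normal P G - facet_normal P F"
    by (simp only: d scaleR_scaleR scaleR_one)
  then show ?thesis by (simp add: algebra_simps)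
qed

text \<open>By induction on the dimension, the facets \<open>F\<close> through \<open>v\<close> have corner vectors \<open>w\<^sub>F\<close>.  The vectors
\<open>N\<^sub>F + t w\<^sub>F\<close> agree for adjacent facets, hence for all facets through \<open>v\<close>; their common value has
product 1 with each \<open>N\<^sub>F\<close> because \<open>w\<^sub>F\<close> is parallel to \<open>F\<close>.\<close>

lemma corner_exists:
  assumes "polytope P" "aff_dim P = int k" "flag_angles k P \<alpha>" "v extreme_point_of P"
  shows "\<exists>w. corner P v w"
  using assms
proof (induction k arbitrary: P)
  case 0
  have "\<not> F facet_of P" for F
  proof
    assume F: "F facet_of P"
    then have "aff_dim F = -1" using 0 by (simp add: facet_of_def)
    then show False using facet_of_nonempty[OF F] by (simp add: aff_dim_empty)
  qed
  moreover have "0 \<in> directions P"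
    using 0 by (intro subspace_0 subspace_directions) (auto simp: extreme_point_of_def)
  ultimately show ?case by (auto simp: corner_def)
next
  case (Suc k)
  note fa = Suc.prems(3)
  note P = \<open>polytope P\<close> and dim = \<open>aff_dim P = int (Suc k)\<close> and v = \<open>v extreme_point_of P\<close>
  let ?t = "tan (\<alpha> (Suc k) / 2)"
  have aP: "ridge_angle P (\<alpha> (Suc k))" by (rule flag_angles_self[OF Suc.prems(3) P dim])
  have vP: "v \<in> P" using v by (simp add: extreme_point_of_def)
  have sub: "subspace (directions P)" using vP by (intro subspace_directions) auto
  \<comment> \<open>a proper face such as \<open>{v}\<close> lies in a facet; inside \<open>F0\<close>, the same argument provides a ridge\<close>
  have "P \<noteq> {v}" using dim by auto
  then obtain F0 where F0: "F0 facet_of P" "{v} \<subseteq> F0"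
    using face_of_polyhedron_subset_facet[OF polytope_imp_polyhedron[OF P], of "{v}"] v
    by (auto simp: face_of_singleton)
  have "\<exists>w. corner F v w" if F: "F facet_of P" "v \<in> F" for F
    using Suc.IH[OF facet_polytope[OF P F(1)] facet_aff_dim[OF F(1) dim]
        flag_angles_facet[OF Suc.prems(3) F(1)] extreme_point_facet[OF F(1) v F(2)]] .
  then obtain w where w: "\<And>F. F facet_of P \<Longrightarrow> v \<in> F \<Longrightarrow> corner F v (w F)" by metis
  define U where "U = (\<lambda>F. facet_normal P F + ?t *\<^sub>R w F)"
  have same: "U J = U F0" if J: "J facet_of P" "v \<in> J" for J
  proof (cases k)
    case 0
    have "F = {v}" if F: "F facet_of P" "v \<in> F" for F
    proof -
      have "aff_dim F = 0" using facet_aff_dim[OF F(1) dim] 0 by simp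
      then obtain a where "F = {a}" using aff_dim_eq_0 by auto
      then show ?thesis using F(2) by auto
    qed
    then have "J = F0" using J F0 by auto
    then show ?thesis by simp
  next
    case (Suc k')
    let ?A = "{F. F facet_of P \<and> v \<in> F \<and> U F = U F0}"
    have vF0: "v extreme_point_of F0" using extreme_point_facet F0 v by blast
    have "F0 \<noteq> {v}" using facet_aff_dim[OF F0(1) dim] Suc by auto
    then obtain R where R: "R facet_of F0" "{v} \<subseteq> R"
      using face_of_polyhedron_subset_facet[OF polytope_imp_polyhedron[OF facet_polytope[OF P F0(1)]], of "{v}"] vF0
      by (auto simp: face_of_singleton)
    obtain G0 where G0: "adjacent_facets P F0 G0" "R = F0 \<inter> G0"
      by (rule facet_of_facet_is_ridge[OF P F0(1) R(1)])
    have "J \<in> ?A"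
    proof (rule facets_at_point_connected[OF P aP _ _ _ G0(1) _ J])
      show "F facet_of P \<and> v \<in> F" if "F \<in> ?A" for F using that by simp
      show "F0 \<in> ?A" using F0 by simp
      show "v \<in> G0" using R(2) G0(2) by auto
    next
      fix F G assume F: "F \<in> ?A" and FG: "adjacent_facets P F G" and vG: "v \<in> G"
      have G: "G facet_of P" using FG by (simp add: adjacent_facets_def)
      have F': "F facet_of P" "v \<in> F" "U F = U F0" using F by auto
      have "facet_normal P F + tan (\<alpha> (Suc (Suc k')) / 2) *\<^sub>R w F
          = facet_normal P G + tan (\<alpha> (Suc (Suc k')) / 2) *\<^sub>R w G"
        by (rule corner_adjacent_facets[OF P dim[unfolded Suc] fa[unfolded Suc] v FG F'(2) vG
              w[OF F'(1,2)] w[OF G vG]])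
      then have "U F = U G" by (simp only: U_def Suc)
      then show "G \<in> ?A" using G vG F'(3) by simp
    qed
    then show ?thesis by simp
  qed
  have "U F0 \<in> directions P"
  proof -
    have wP: "w F0 \<in> directions P"
      using w[OF F0(1)] F0(2) directions_facet_iff[OF P F0(1)] by (auto simp: corner_def)
    show ?thesis
      using subspace_add[OF sub facet_normal_props(2)[OF P F0(1)] subspace_scale[OF sub wP]]
      by (simp add: U_def)
  qed
  moreover have "facet_normal P J \<bullet> U F0 = 1" if J: "J facet_of P" "v \<in> J" for J
  proof -
    have "facet_normal P J \<bullet> w J = 0"
      using w[OF J] directions_facet_iff[OF P J(1)] by (auto simp: corner_def)
    then have "facet_normal P J \<bullet> U J = 1"
      using facet_normal_props(1)[OF P J(1)] by (simp add: U_def inner_add_right norm_eq_1)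
    then show ?thesis using same[OF J] by simp
  qed
  ultimately show ?case by (auto simp: corner_def)
qed

section \<open>Slices of the layers parallel to a facet\<close>

text \<open>The inner parallel body of \<open>P\<close> relative to its affine hull, in terms of the facet hyperplanes.\<close>

definition inset :: "'a::euclidean_space set \<Rightarrow> real \<Rightarrow> 'a set" where
  "inset P r = {x \<in> P. \<forall>F. F facet_of P \<longrightarrow> r \<le> facet_dist P F x}"

text \<open>The left-hand side is the slice at height \<open>s\<close> of the region where \<open>F\<close> is the nearest facet.  For a facet
\<open>J\<close> that meets \<open>F\<close>, take a vertex \<open>v\<close> of \<open>J \<inter> F\<close> and the corner vector \<open>w\<close> of \<open>F\<close> at \<open>v\<close>.  If \<open>y\<close> has
distance at least \<open>t s\<close> from the facets of \<open>F\<close>, then \<open>y - t s w\<close> still lies in the cone of \<open>F\<close> at \<open>v\<close>, hence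
on the inner side of \<open>J\<close>.  As \<open>N\<^sub>J \<bullet> (N\<^sub>F + t w) = 1\<close>, adding \<open>s (N\<^sub>F + t w)\<close> to this point raises its distance
to \<open>J\<close> by exactly \<open>s\<close>.  The only restriction on \<open>s\<close> comes from the facets disjoint from \<open>F\<close>.\<close>

lemma inset_slice_eq:
  assumes P: "polytope P" and dim: "aff_dim P = int (Suc k)" and \<alpha>: "flag_angles (Suc k) P \<alpha>"
    and F: "F facet_of P"
  shows "\<exists>\<epsilon>>0. \<forall>s y. 0 \<le> s \<longrightarrow> s \<le> \<epsilon> \<longrightarrow> y \<in> affine hull F \<longrightarrow>
    (\<forall>J. J facet_of P \<longrightarrow> s \<le> facet_dist P J (y + s *\<^sub>R facet_normal P F))
      \<longleftrightarrow> y \<in> inset F (tan (\<alpha> (Suc k) / 2) * s)"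
proof -
  let ?a = "\<alpha> (Suc k)" and ?N = "facet_normal P F"
  let ?t = "tan (?a / 2)"
  have aP: "ridge_angle P ?a" by (rule flag_angles_self[OF \<alpha> P dim])
  then have a: "0 < ?a" "?a < pi" by (auto simp: ridge_angle_def)
  have t: "?t > 0" and ts: "?t * sin ?a = 1 - cos ?a" by (rule tan_half_angle[OF a])+
  have s0: "sin ?a > 0" using a by (rule sin_gt_zero)
  have pF: "polytope F" by (rule facet_polytope[OF P F])
  have FP: "F \<subseteq> P" by (rule facet_of_imp_subset[OF F])
  have n: "norm ?N = 1" by (rule facet_normal_props[OF P F])
  have subF: "subspace (directions F)" by (rule subspace_directions[OF facet_of_nonempty[OF F]])
  have NF: "facet_dist P F (y + s *\<^sub>R ?N) = s" if "y \<in> affine hull F" for y s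
    using that facet_dist_hull[OF P F] n by (auto simp: facet_dist_add norm_eq_1)
  have far: "\<exists>\<delta>>0. \<forall>y\<in>F. \<delta> \<le> facet_dist P J y" if J: "J facet_of P" "J \<inter> F = {}" for J
  proof -
    have "continuous_on F (facet_dist P J)" unfolding facet_dist_def by (intro continuous_intros)
    then obtain y0 where y0: "y0 \<in> F" "\<And>y. y \<in> F \<Longrightarrow> facet_dist P J y0 \<le> facet_dist P J y"
      using continuous_attains_inf[OF polytope_imp_compact[OF pF] facet_of_nonempty[OF F]] by metis
    have "facet_dist P J y0 > 0" using y0(1) J FP by (intro facet_dist_pos[OF P]) auto
    then show ?thesis using y0(2) by auto
  qed
  then obtain \<delta> where \<delta>: "\<And>J. J facet_of P \<Longrightarrow> J \<inter> F = {} \<Longrightarrow> \<delta> J > 0"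
    "\<And>J y. J facet_of P \<Longrightarrow> J \<inter> F = {} \<Longrightarrow> y \<in> F \<Longrightarrow> \<delta> J \<le> facet_dist P J y" by metis
  let ?D = "insert 1 (\<delta> ` {J. J facet_of P \<and> J \<inter> F = {}})"
  have fin: "finite ?D" using finite_polytope_facets[OF P] by simp
  \<comment> \<open>moving by \<open>s \<le> \<epsilon>\<close> off a point of \<open>F\<close> costs at most \<open>\<epsilon>\<close> of its distance, at least \<open>2 \<epsilon>\<close>, to a facet
    disjoint from \<open>F\<close>; the element 1 only makes the minimum meaningful when there is no such facet\<close>
  define \<epsilon> where "\<epsilon> = Min ?D / 2"
  have "Min ?D > 0" using fin \<delta>(1) by (subst Min_gr_iff) auto
  then have e0: "\<epsilon> > 0" by (simp add: \<epsilon>_def)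
  have e: "2 * \<epsilon> \<le> \<delta> J" if "J facet_of P" "J \<inter> F = {}" for J
    unfolding \<epsilon>_def using fin that by (auto intro!: Min_le)
  show ?thesis
  proof (intro exI[of _ \<epsilon>] conjI allI impI e0 iffI)
    fix s y assume s: "0 \<le> s" "s \<le> \<epsilon>" and y: "y \<in> affine hull F"
      and L: "\<forall>J. J facet_of P \<longrightarrow> s \<le> facet_dist P J (y + s *\<^sub>R ?N)"
    have R: "?t * s \<le> facet_dist F R y" if R: "R facet_of F" for R
    proof -
      obtain G where G: "adjacent_facets P F G" "R = F \<inter> G" by (rule facet_of_facet_is_ridge[OF P F R])
      have ne: "F \<inter> G \<noteq> {}" using facet_of_nonempty[OF R] G(2) by simp
      have GP: "G facet_of P" using G(1) by (auto simp: adjacent_facets_def)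
      have NG: "facet_normal P G \<bullet> ?N = cos ?a"
        using aP G(1) ne by (auto simp: ridge_angle_def inner_commute)
      have "s \<le> facet_dist P G y + s * cos ?a" using L[rule_format, OF GP] NG by (simp add: facet_dist_add)
      then have "(?t * sin ?a) * s \<le> facet_dist P G y" unfolding ts by (simp add: algebra_simps)
      then show ?thesis
        unfolding G(2) ridge_normal(2)[OF P aP G(1) ne y] using s0 by (simp add: field_simps)
    qed
    have "0 \<le> ?t * s" using t s by simp
    then have "y \<in> F" using polytope_mem_iff[OF pF, of y] y R by force
    then show "y \<in> inset F (?t * s)" using R by (simp add: inset_def)
  next
    fix s y J assume s: "0 \<le> s" "s \<le> \<epsilon>" and y: "y \<in> affine hull F"
      and I: "y \<in> inset F (?t * s)" and J: "J facet_of P"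
    have yF: "y \<in> F" and yR: "\<And>R. R facet_of F \<Longrightarrow> ?t * s \<le> facet_dist F R y"
      using I by (auto simp: inset_def)
    have JN: "facet_dist P J (y + s *\<^sub>R ?N) = facet_dist P J y + s * (facet_normal P J \<bullet> ?N)"
      by (simp add: facet_dist_add)
    show "s \<le> facet_dist P J (y + s *\<^sub>R ?N)"
    proof (cases "J \<inter> F = {}")
      case True
      have "\<bar>facet_normal P J \<bullet> ?N\<bar> \<le> 1"
        using Cauchy_Schwarz_ineq2[of "facet_normal P J" ?N] n facet_normal_props(1)[OF P J] by simp
      then have "s * (-1) \<le> s * (facet_normal P J \<bullet> ?N)" using s(1) by (intro mult_left_mono) auto
      moreover have "2 * \<epsilon> \<le> facet_dist P J y" using e[OF J True] \<delta>(2)[OF J True yF] by simp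
      ultimately show ?thesis using JN s by simp
    next
      case False
      have JF: "J \<inter> F face_of P"
        using J F by (intro face_of_Int facet_of_imp_face_of)
      then have "polytope (J \<inter> F)" by (rule face_of_polytope_polytope[OF P])
      then obtain v where v: "v extreme_point_of (J \<inter> F)"
        using extreme_point_exists_convex[OF polytope_imp_compact polytope_imp_convex False] by metis
      then have vP: "v extreme_point_of P" and vJF: "v \<in> J" "v \<in> F"
        using extreme_point_of_face[OF JF] by auto
      obtain U where U: "corner P v U" using corner_exists[OF P dim \<alpha> vP] by auto
      obtain w where w: "corner F v w" "U = ?N + ?t *\<^sub>R w"
        by (rule corner_of_facet[OF P aP F vJF(2) U])
      define z where "z = y - (?t * s) *\<^sub>R w"
      have zy: "z = y + (- (?t * s)) *\<^sub>R w" by (simp add: z_def)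
      have wF: "w \<in> directions F" using w(1) by (simp add: corner_def)
      have zh: "z \<in> affine hull F"
        unfolding zy by (rule directions_iff[OF y, THEN iffD1]) (rule subspace_scale[OF subF wF])
      have "0 \<le> facet_dist P J z"
      proof (rule facet_cone_subset_cone[OF P F vJF(2) zh _ J vJF(1)])
        fix R assume R: "R facet_of F" "v \<in> R"
        then have "facet_normal F R \<bullet> w = 1" using w(1) by (simp add: corner_def)
        then show "0 \<le> facet_dist F R z" using yR[OF R(1)] by (simp add: z_def facet_dist_minus)
      qed
      moreover have "facet_normal P J \<bullet> U = 1" using U J vJF(1) by (simp add: corner_def)
      then have "?t * (facet_normal P J \<bullet> w) = 1 - facet_normal P J \<bullet> ?N"
        unfolding w(2) by (simp add: inner_add_right)
      then have "(?t * s) * (facet_normal P J \<bullet> w) = s * (1 - facet_normal P J \<bullet> ?N)"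
        by (simp add: mult.assoc mult.left_commute)
      ultimately show ?thesis unfolding JN by (simp add: z_def facet_dist_minus algebra_simps)
    qed
  qed
qed

section \<open>Decomposition of a polytope into layers\<close>

lemma continuous_on_facet_dist [continuous_intros]: "continuous_on S (facet_dist P F)"
  unfolding facet_dist_def by (intro continuous_intros)

lemma closed_inset:
  assumes "polytope P"
  shows "closed (inset P r)"
proof -
  have "inset P r = P \<inter> (\<Inter>F\<in>{F. F facet_of P}. {x. r \<le> facet_dist P F x})"
    by (auto simp: inset_def)
  then show ?thesis
    using polytope_imp_closed[OF assms]
    by (auto intro!: closed_Int closed_INT closed_Collect_le continuous_intros)
qed

text \<open>Together with \<open>inset P r\<close> the layers of the facets cover \<open>P\<close>; the strict bound by \<open>r\<close> keeps them disjoint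
from it.\<close>

definition layer :: "'a::euclidean_space set \<Rightarrow> 'a set \<Rightarrow> real \<Rightarrow> 'a set" where
  "layer P F r = {x \<in> P. facet_dist P F x < r \<and>
     (\<forall>J. J facet_of P \<longrightarrow> facet_dist P F x \<le> facet_dist P J x)}"

lemma layer_borel:
  assumes "polytope P"
  shows "layer P F r \<in> sets borel"
proof -
  have eq: "layer P F r = (P \<inter> (\<Inter>J\<in>{J. J facet_of P}. {x. facet_dist P F x \<le> facet_dist P J x}))
      \<inter> {x. facet_dist P F x < r}"
    by (auto simp: layer_def)
  have "closed (P \<inter> (\<Inter>J\<in>{J. J facet_of P}. {x. facet_dist P F x \<le> facet_dist P J x}))"
    using polytope_imp_closed[OF assms]
    by (auto intro!: closed_Int closed_INT closed_Collect_le continuous_intros)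
  moreover have "open {x. facet_dist P F x < r}"
    by (intro open_Collect_less continuous_intros)
  ultimately show ?thesis unfolding eq by (intro sets.Int borel_closed borel_open)
qed

lemma facet_normals_distinct:
  assumes P: "polytope P" and F: "F facet_of P" and G: "G facet_of P"
    and eq: "facet_normal P F = facet_normal P G"
  shows "F = G"
proof (rule ccontr)
  assume ne: "F \<noteq> G"
  obtain w where w: "w \<in> F" "w \<notin> G" using facets_incomparable[OF P F G ne] by auto
  obtain y where y: "y \<in> G" "y \<notin> F" using facets_incomparable[OF P G F] ne by auto
  have wyP: "w \<in> P" "y \<in> P" using w y facet_of_imp_subset[OF F] facet_of_imp_subset[OF G] by auto
  have "facet_dist P F w - facet_dist P F y = facet_dist P G w - facet_dist P G y"
    by (simp add: facet_dist_diff eq)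
  then show False
    using facet_dist_zero[OF P F w(1)] facet_dist_zero[OF P G y(1)]
      facet_dist_pos[OF P F wyP(2) y(2)] facet_dist_pos[OF P G wyP(1) w(2)] by simp
qed

text \<open>On the overlap the two signed distances agree, and their difference is a non-constant affine function on
the flat of \<open>P\<close> because distinct facets have distinct normals.\<close>

lemma layers_overlap_null:
  assumes P: "polytope P" and dim: "aff_dim P = int (Suc k)"
    and F: "F facet_of P" and G: "G facet_of P" and ne: "F \<noteq> G"
  shows "AE x in flat_vol (Suc k) P. x \<notin> layer P F r \<or> x \<notin> layer P G r"
proof -
  define M where "M = facet_normal P F - facet_normal P G"
  have "M \<noteq> 0" using facet_normals_distinct[OF P F G] ne by (auto simp: M_def)
  moreover have "M \<in> directions P"
    unfolding M_def using facet_of_nonempty[OF F] facet_of_imp_subset[OF F]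
    by (intro subspace_diff subspace_directions facet_normal_props(2)[OF P] F G) auto
  define c where "c = facet_dist P G 0 - facet_dist P F 0"
  have sub: "layer P F r \<inter> layer P G r \<subseteq> {x. M \<bullet> x = c}"
  proof
    fix x assume "x \<in> layer P F r \<inter> layer P G r"
    then have "facet_dist P F x = facet_dist P G x"
      using F G by (auto simp: layer_def intro!: antisym)
    then show "x \<in> {x. M \<bullet> x = c}"
      using facet_dist_diff[of P F x 0] facet_dist_diff[of P G x 0]
      by (simp add: M_def c_def inner_diff_left)
  qed
  have "emeasure (flat_vol (Suc k) P) {x. M \<bullet> x = c} = 0"
    by (rule emeasure_flat_vol_hyperplane[OF dim \<open>M \<in> directions P\<close> \<open>M \<noteq> 0\<close>])
  then show ?thesis
    using sub dim by (intro AE_I[of _ _ "{x. M \<bullet> x = c}"]) (auto intro: borel_closed closed_hyperplane)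
qed

lemma measure_inset_layers:
  assumes P: "polytope P" and dim: "aff_dim P = int (Suc k)"
  defines "\<mu> \<equiv> flat_vol (Suc k) P"
  shows "measure \<mu> P = measure \<mu> (inset P r) + (\<Sum>F\<in>{F. F facet_of P}. measure \<mu> (layer P F r))"
proof -
  let ?Fs = "{F. F facet_of P}"
  have fin: "finite ?Fs" by (rule finite_polytope_facets[OF P])
  have sets: "sets \<mu> = sets borel" unfolding \<mu>_def by (rule sets_flat_vol(1)[OF dim])
  have fm: "S \<in> fmeasurable \<mu>" if "S \<subseteq> P" "S \<in> sets borel" for S
    using that emeasure_flat_vol_bounded[OF dim bounded_subset[OF polytope_imp_bounded[OF P]]] sets
    unfolding \<mu>_def fmeasurable_def by auto
  have fmL: "layer P F r \<in> fmeasurable \<mu>" for F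
    using layer_borel[OF P] by (intro fm) (auto simp: layer_def)
  have fmI: "inset P r \<in> fmeasurable \<mu>"
    using closed_inset[OF P] by (intro fm borel_closed) (auto simp: inset_def)
  have disj: "inset P r \<inter> (\<Union>F\<in>?Fs. layer P F r) = {}"
    by (force simp: inset_def layer_def)
  have cover: "P = inset P r \<union> (\<Union>F\<in>?Fs. layer P F r)"
  proof (intro equalityI subsetI)
    fix x assume x: "x \<in> P"
    show "x \<in> inset P r \<union> (\<Union>F\<in>?Fs. layer P F r)"
    proof (cases "x \<in> inset P r")
      case False
      then obtain F where F: "F facet_of P" "facet_dist P F x < r" using x by (auto simp: inset_def)
      then have "?Fs \<noteq> {}" by auto
      then obtain J where J: "J \<in> ?Fs" "\<And>G. G \<in> ?Fs \<Longrightarrow> facet_dist P J x \<le> facet_dist P G x"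
        using arg_min_if_finite(1)[OF fin] arg_min_least[OF fin] by metis
      then have "x \<in> layer P J r" using x F by (force simp: layer_def)
      then show ?thesis using J(1) by blast
    qed simp
  qed (auto simp: inset_def layer_def)
  have "(\<Union>F\<in>?Fs. layer P F r) \<in> fmeasurable \<mu>"
    using fin fmL by (intro fmeasurable.finite_UN) auto
  then have "measure \<mu> (inset P r \<union> (\<Union>F\<in>?Fs. layer P F r))
      = measure \<mu> (inset P r) + measure \<mu> (\<Union>F\<in>?Fs. layer P F r)"
    using disj fmI by (intro measure_Un_AE) auto
  then have "measure \<mu> P = measure \<mu> (inset P r) + measure \<mu> (\<Union>F\<in>?Fs. layer P F r)"
    by (simp only: cover[symmetric])
  also have "measure \<mu> (\<Union>F\<in>?Fs. layer P F r) = (\<Sum>F\<in>?Fs. measure \<mu> (layer P F r))"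
  proof (rule measure_UNION_AE[OF fin fmL])
    show "pairwise (\<lambda>F G. AE x in \<mu>. x \<notin> layer P F r \<or> x \<notin> layer P G r) ?Fs"
      unfolding \<mu>_def by (intro pairwiseI layers_overlap_null[OF P dim]) simp_all
  qed
  finally show ?thesis .
qed

text \<open>Fubini along the normal of \<open>F\<close>; the integral of the slice volumes \<open>g\<close> is evaluated with a primitive \<open>G\<close>.\<close>

lemma measure_layer:
  assumes P: "polytope P" and dim: "aff_dim P = int (Suc k)" and F: "F facet_of P"
    and r: "0 \<le> r"
    and slice: "\<And>s y. 0 \<le> s \<Longrightarrow> s \<le> r \<Longrightarrow> y \<in> affine hull F \<Longrightarrow>
      (\<forall>J. J facet_of P \<longrightarrow> s \<le> facet_dist P J (y + s *\<^sub>R facet_normal P F)) \<longleftrightarrow> y \<in> inset F (t * s)"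
    and g: "\<And>s. 0 \<le> s \<Longrightarrow> s \<le> r \<Longrightarrow> measure (flat_vol k F) (inset F (t * s)) = g s"
    and G: "\<And>s. 0 \<le> s \<Longrightarrow> s \<le> r \<Longrightarrow> (G has_real_derivative g s) (at s)" "G 0 = 0"
    and gm: "g \<in> borel_measurable borel"
  shows "measure (flat_vol (Suc k) P) (layer P F r) = G r"
proof -
  let ?N = "facet_normal P F"
  have pF: "polytope F" by (rule facet_polytope[OF P F])
  have dF: "aff_dim F = int k" by (rule facet_aff_dim[OF F dim])
  obtain p where p: "p \<in> F" using facet_of_nonempty[OF F] by auto
  have N: "norm ?N = 1" "?N \<in> directions P" by (rule facet_normal_props[OF P F])+
  have NF: "facet_dist P F (y + s *\<^sub>R ?N) = s" if "y \<in> affine hull F" for y s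
    using that facet_dist_hull[OF P F] N by (auto simp: facet_dist_add norm_eq_1)
  have inb: "inset F s \<in> sets borel" for s by (rule borel_closed[OF closed_inset[OF pF]])
  have Lb: "{y. y + s *\<^sub>R ?N \<in> layer P F r} \<in> sets borel" for s
    using measurable_sets[of "\<lambda>y. y + s *\<^sub>R ?N" borel borel, OF _ layer_borel[OF P, of F r]]
    by (simp add: vimage_def)
  have mem: "y + s *\<^sub>R ?N \<in> layer P F r \<longleftrightarrow> 0 \<le> s \<and> s < r \<and> y \<in> inset F (t * s)"
    if y: "y \<in> affine hull F" for y s
  proof -
    have "y \<in> affine hull P" using y hull_mono[OF facet_of_imp_subset[OF F]] by blast
    then have h: "y + s *\<^sub>R ?N \<in> affine hull P"
      by (rule directions_iff[THEN iffD1]) 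
        (rule subspace_scale[OF subspace_directions N(2)], use p facet_of_imp_subset[OF F] in auto)
    have "y + s *\<^sub>R ?N \<in> layer P F r \<longleftrightarrow> 0 \<le> s \<and> s < r \<and>
        (\<forall>J. J facet_of P \<longrightarrow> s \<le> facet_dist P J (y + s *\<^sub>R ?N))"
      unfolding layer_def mem_Collect_eq polytope_mem_iff[OF P, of "y + s *\<^sub>R ?N"] NF[OF y]
      using h F NF[OF y, of s] by force
    then show ?thesis using slice[OF _ _ y, of s] by auto
  qed
  have fin: "emeasure (flat_vol k F) (inset F s) < \<infinity>" for s
    using bounded_subset[OF polytope_imp_bounded[OF pF]] inb
    by (intro emeasure_flat_vol_bounded[OF dF]) (auto simp: inset_def)
  have gnn: "0 \<le> g s" if "0 \<le> s" "s \<le> r" for s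
    using g[OF that] measure_nonneg by metis
  have "emeasure (flat_vol (Suc k) P) (layer P F r)
      = (\<integral>\<^sup>+s. emeasure (flat_vol k F) {y. y + s *\<^sub>R ?N \<in> layer P F r} \<partial>lborel)"
    by (rule emeasure_flat_vol_slices[OF dF hull_inc[OF p] facet_affine_hull[OF F facet_normal[OF P F] p]
          N(2,1) layer_borel[OF P]])
  also have "\<dots> = (\<integral>\<^sup>+s. ennreal (g s) * indicator {0..r} s \<partial>lborel)"
  proof (rule nn_integral_cong_AE)
    have "emeasure (flat_vol k F) {y. y + s *\<^sub>R ?N \<in> layer P F r} = ennreal (g s) * indicator {0..r} s"
      if "s \<noteq> r" for s
    proof (cases "0 \<le> s \<and> s < r")
      case True
      then have "emeasure (flat_vol k F) {y. y + s *\<^sub>R ?N \<in> layer P F r} = emeasure (flat_vol k F) (inset F (t * s))"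
        using mem by (intro emeasure_flat_vol_cong[OF dF Lb inb]) auto
      also have "\<dots> = ennreal (g s)"
        using g[of s] True fin[of "t * s"] by (simp add: emeasure_eq_ennreal_measure)
      finally show ?thesis using True by simp
    next
      case False
      then have "emeasure (flat_vol k F) {y. y + s *\<^sub>R ?N \<in> layer P F r} = emeasure (flat_vol k F) {}"
        using mem by (intro emeasure_flat_vol_cong[OF dF Lb]) auto
      then show ?thesis using False that by auto
    qed
    moreover have "AE s in lborel. s \<noteq> r" by (rule AE_lborel_singleton)
    ultimately show "AE s in lborel. emeasure (flat_vol k F) {y. y + s *\<^sub>R ?N \<in> layer P F r}
        = ennreal (g s) * indicator {0..r} s"
      by (auto elim: eventually_mono)
  qed
  also have "\<dots> = ennreal (G r - G 0)"
    using gm G(1) gnn r by (intro nn_integral_FTC_Icc) auto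
  finally have e: "emeasure (flat_vol (Suc k) P) (layer P F r) = ennreal (G r)" using G(2) by simp
  have "G 0 \<le> G r"
  proof (rule DERIV_nonneg_imp_nondecreasing[OF r])
    fix x assume "0 \<le> x" "x \<le> r"
    then show "\<exists>y. (G has_real_derivative y) (at x) \<and> 0 \<le> y" using G(1) gnn by blast
  qed
  then show ?thesis using G(2) e by (simp add: measure_def)
qed

section \<open>The volume polynomial\<close>

text \<open>The right-hand side of the claimed formula.\<close>

definition inset_volume :: "nat \<Rightarrow> (nat \<Rightarrow> real) \<Rightarrow> 'a::euclidean_space set \<Rightarrow> real \<Rightarrow> real" where
  "inset_volume d \<alpha> P r =
     (\<Sum>k=0..d. (-1) ^ (d - k) * Omega d k P * (\<Prod>j=k+1..d. gam d \<alpha> j)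
          * (r ^ (d - k) / fact (d - k)))"

lemma gam_self: "gam d \<alpha> d = 1"
  by (simp add: gam_def)

lemma gam_Suc: "j \<le> d \<Longrightarrow> gam (Suc d) \<alpha> j = gam d \<alpha> j * tan (\<alpha> (Suc d) / 2)"
  by (simp add: gam_def)

lemma prod_gam_Suc:
  assumes "k \<le> d"
  shows "(\<Prod>j=k+1..Suc d. gam (Suc d) \<alpha> j)
    = (\<Prod>j=k+1..d. gam d \<alpha> j) * tan (\<alpha> (Suc d) / 2) ^ (d - k)"
proof -
  have "(\<Prod>j=k+1..Suc d. gam (Suc d) \<alpha> j) = (\<Prod>j=k+1..d. gam (Suc d) \<alpha> j)"
    using assms by (simp add: gam_self)
  also have "\<dots> = (\<Prod>j=k+1..d. gam d \<alpha> j * tan (\<alpha> (Suc d) / 2))"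
    by (intro prod.cong) (auto simp: gam_Suc)
  finally show ?thesis by (simp add: prod.distrib)
qed

text \<open>The primitive, vanishing at 0, of \<open>s \<mapsto> inset_volume d \<alpha> F (t s)\<close> with \<open>t = tan (\<alpha>\<^sub>d\<^sub>+\<^sub>1 / 2)\<close>: the volume
of the layer at a facet \<open>F\<close> of a \<open>(d+1)\<close>-dimensional polytope.\<close>

definition layer_volume :: "nat \<Rightarrow> (nat \<Rightarrow> real) \<Rightarrow> 'a::euclidean_space set \<Rightarrow> real \<Rightarrow> real" where
  "layer_volume d \<alpha> F r =
     (\<Sum>k=0..d. (-1) ^ (d - k) * Omega d k F * (\<Prod>j=k+1..d. gam d \<alpha> j)
          * (tan (\<alpha> (Suc d) / 2) ^ (d - k) * (r ^ (Suc d - k) / fact (Suc d - k))))"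

lemma layer_volume_0: "layer_volume d \<alpha> F 0 = 0"
  by (auto simp: layer_volume_def intro!: sum.neutral)

lemma layer_volume_deriv:
  "(layer_volume d \<alpha> F has_real_derivative inset_volume d \<alpha> F (tan (\<alpha> (Suc d) / 2) * s)) (at s)"
proof -
  have 1: "((\<lambda>r::real. r ^ Suc n / fact (Suc n)) has_real_derivative s ^ n / fact n) (at s)" for n
    by (rule derivative_eq_intros refl | simp add: divide_simps)+
  have "((\<lambda>r. \<Sum>k=0..d. (-1) ^ (d - k) * Omega d k F * (\<Prod>j=k+1..d. gam d \<alpha> j)
          * (tan (\<alpha> (Suc d) / 2) ^ (d - k) * (r ^ Suc (d - k) / fact (Suc (d - k)))))
    has_real_derivative (\<Sum>k=0..d. (-1) ^ (d - k) * Omega d k F * (\<Prod>j=k+1..d. gam d \<alpha> j)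
          * (tan (\<alpha> (Suc d) / 2) ^ (d - k) * (s ^ (d - k) / fact (d - k))))) (at s)"
    by (intro DERIV_sum DERIV_cmult 1)
  moreover have "layer_volume d \<alpha> F = (\<lambda>r. \<Sum>k=0..d. (-1) ^ (d - k) * Omega d k F * (\<Prod>j=k+1..d. gam d \<alpha> j)
          * (tan (\<alpha> (Suc d) / 2) ^ (d - k) * (r ^ Suc (d - k) / fact (Suc (d - k)))))"
    unfolding layer_volume_def by (intro ext sum.cong) (auto simp: Suc_diff_le)
  ultimately show ?thesis by (simp add: inset_volume_def power_mult_distrib)
qed

text \<open>Passing from dimension \<open>d\<close> to \<open>d + 1\<close> multiplies each \<open>\<gamma>\<^sub>j\<close> with \<open>j \<le> d\<close> by \<open>t = tan (\<alpha>\<^sub>d\<^sub>+\<^sub>1 / 2)\<close>, while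
\<open>\<gamma>\<^sub>d\<^sub>+\<^sub>1 = 1\<close>.  So the product \<open>\<gamma>\<^sub>k\<^sub>+\<^sub>1 \<dots> \<gamma>\<^sub>d\<close> acquires the factor \<open>t\<^sup>d\<^sup>-\<^sup>k\<close>, which is the one
produced by the substitution of \<open>t s\<close> in the polynomial of a facet.\<close>

lemma inset_volume_Suc:
  "inset_volume (Suc d) \<alpha> P r = vol (Suc d) P - (\<Sum>F\<in>{F. F facet_of P}. layer_volume d \<alpha> F r)"
proof -
  have "inset_volume (Suc d) \<alpha> P r =
     (\<Sum>k=0..d. (-1) ^ (Suc d - k) * Omega (Suc d) k P * (\<Prod>j=k+1..Suc d. gam (Suc d) \<alpha> j)
          * (r ^ (Suc d - k) / fact (Suc d - k))) + vol (Suc d) P"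
    unfolding inset_volume_def by (subst sum.atLeast0_atMost_Suc) simp
  also have "(\<Sum>k=0..d. (-1) ^ (Suc d - k) * Omega (Suc d) k P * (\<Prod>j=k+1..Suc d. gam (Suc d) \<alpha> j)
          * (r ^ (Suc d - k) / fact (Suc d - k)))
     = (\<Sum>k=0..d. - (\<Sum>F\<in>{F. F facet_of P}. (-1) ^ (d - k) * Omega d k F * (\<Prod>j=k+1..d. gam d \<alpha> j)
          * (tan (\<alpha> (Suc d) / 2) ^ (d - k) * (r ^ (Suc d - k) / fact (Suc d - k)))))"
  proof (intro sum.cong refl)
    fix k assume "k \<in> {0..d}"
    then have k: "k \<le> d" by simp
    then have "Omega (Suc d) k P = (\<Sum>F\<in>{F. F facet_of P}. Omega d k F)" by simp
    moreover have "(-1::real) ^ (Suc d - k) = - ((-1) ^ (d - k))" using k by (simp add: Suc_diff_le)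
    ultimately show "(-1) ^ (Suc d - k) * Omega (Suc d) k P * (\<Prod>j=k+1..Suc d. gam (Suc d) \<alpha> j)
          * (r ^ (Suc d - k) / fact (Suc d - k))
      = - (\<Sum>F\<in>{F. F facet_of P}. (-1) ^ (d - k) * Omega d k F * (\<Prod>j=k+1..d. gam d \<alpha> j)
          * (tan (\<alpha> (Suc d) / 2) ^ (d - k) * (r ^ (Suc d - k) / fact (Suc d - k))))"
      by (simp only: prod_gam_Suc[OF k]) (simp add: sum_distrib_left sum_distrib_right sum_negf mult_ac)
  qed
  also have "\<dots> = - (\<Sum>F\<in>{F. F facet_of P}. layer_volume d \<alpha> F r)"
    unfolding layer_volume_def sum_negf by (subst sum.swap) (rule refl)
  finally show ?thesis by simp
qed

text \<open>Induction on the dimension: the layers at the facets have the volumes \<open>layer_volume\<close> as long as all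
the slices are inner parallel bodies of facets in the range of the induction hypothesis, and
\<open>inset_volume_Suc\<close> is the resulting recursion.\<close>

lemma measure_inset:
  assumes "polytope P" "aff_dim P = int k" "flag_angles k P \<alpha>"
  shows "\<exists>\<epsilon>>0. \<forall>r. 0 \<le> r \<longrightarrow> r \<le> \<epsilon> \<longrightarrow>
    measure (flat_vol k P) (inset P r) = inset_volume k \<alpha> P r"
  using assms
proof (induction k arbitrary: P)
  case 0
  then obtain a where P: "P = {a}" using aff_dim_eq_0[of P] by auto
  have "\<not> F facet_of P" for F
  proof
    assume F: "F facet_of P"
    then have "aff_dim F = -1" using 0 by (simp add: facet_of_def)
    then show False using facet_of_nonempty[OF F] by (simp add: aff_dim_empty)
  qed
  then have "inset P r = P" for r by (simp add: inset_def)
  moreover have "vol 0 P = measure (flat_vol 0 P) P"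
    using 0 by (intro vol_eq_flat_vol) (auto simp: P)
  ultimately show ?case by (intro exI[of _ 1]) (simp add: inset_volume_def)
next
  case (Suc k)
  note P = Suc.prems(1) and dim = Suc.prems(2) and fa = Suc.prems(3)
  let ?Fs = "{F. F facet_of P}"
  define t where "t = tan (\<alpha> (Suc k) / 2)"
  have "0 < \<alpha> (Suc k)" "\<alpha> (Suc k) < pi"
    using flag_angles_self[OF fa P dim] by (auto simp: ridge_angle_def)
  then have t: "t > 0" unfolding t_def by (rule tan_half_angle(1))
  have "\<exists>\<epsilon>>0. (\<forall>s y. 0 \<le> s \<longrightarrow> s \<le> \<epsilon> \<longrightarrow> y \<in> affine hull F \<longrightarrow>
      (\<forall>J. J facet_of P \<longrightarrow> s \<le> facet_dist P J (y + s *\<^sub>R facet_normal P F)) \<longleftrightarrow> y \<in> inset F (t * s)) \<and>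
      (\<forall>s. 0 \<le> s \<longrightarrow> s \<le> \<epsilon> \<longrightarrow> measure (flat_vol k F) (inset F (t * s)) = inset_volume k \<alpha> F (t * s))"
    if F: "F facet_of P" for F
  proof -
    obtain e1 where e1: "e1 > 0" "\<And>s y. 0 \<le> s \<Longrightarrow> s \<le> e1 \<Longrightarrow> y \<in> affine hull F \<Longrightarrow>
      (\<forall>J. J facet_of P \<longrightarrow> s \<le> facet_dist P J (y + s *\<^sub>R facet_normal P F)) \<longleftrightarrow> y \<in> inset F (t * s)"
      using inset_slice_eq[OF P dim fa F] unfolding t_def by auto
    obtain e2 where e2: "e2 > 0" "\<And>r. 0 \<le> r \<Longrightarrow> r \<le> e2 \<Longrightarrow>
        measure (flat_vol k F) (inset F r) = inset_volume k \<alpha> F r"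
      using Suc.IH[OF facet_polytope[OF P F] facet_aff_dim[OF F dim] flag_angles_facet[OF fa F]] by auto
    show ?thesis
    proof (intro exI[of _ "min e1 (e2 / t)"] conjI allI impI)
      show "0 < min e1 (e2 / t)" using e1 e2 t by simp
    next
      fix s assume s: "0 \<le> s" "s \<le> min e1 (e2 / t)"
      have "t * s \<le> e2" using s t by (simp add: field_simps)
      then show "measure (flat_vol k F) (inset F (t * s)) = inset_volume k \<alpha> F (t * s)"
        using s t by (intro e2) auto
    qed (use e1(2) in auto)
  qed
  then obtain e where e: "\<And>F. F facet_of P \<Longrightarrow> e F > 0"
    and slice: "\<And>F s y. F facet_of P \<Longrightarrow> 0 \<le> s \<Longrightarrow> s \<le> e F \<Longrightarrow> y \<in> affine hull F \<Longrightarrow>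
      (\<forall>J. J facet_of P \<longrightarrow> s \<le> facet_dist P J (y + s *\<^sub>R facet_normal P F)) \<longleftrightarrow> y \<in> inset F (t * s)"
    and IH: "\<And>F s. F facet_of P \<Longrightarrow> 0 \<le> s \<Longrightarrow> s \<le> e F \<Longrightarrow>
      measure (flat_vol k F) (inset F (t * s)) = inset_volume k \<alpha> F (t * s)"
    by metis
  define \<epsilon> where "\<epsilon> = Min (insert 1 (e ` ?Fs))"
  have fin: "finite ?Fs" by (rule finite_polytope_facets[OF P])
  have "\<epsilon> > 0" unfolding \<epsilon>_def using fin e by (subst Min_gr_iff) auto
  moreover have "measure (flat_vol (Suc k) P) (inset P r) = inset_volume (Suc k) \<alpha> P r"
    if r: "0 \<le> r" "r \<le> \<epsilon>" for r
  proof -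
    have L: "measure (flat_vol (Suc k) P) (layer P F r) = layer_volume k \<alpha> F r" if F: "F facet_of P" for F
    proof (rule measure_layer[OF P dim F r(1), where t = t and g = "\<lambda>s. inset_volume k \<alpha> F (t * s)"])
      have "\<epsilon> \<le> e F" unfolding \<epsilon>_def using fin F by (intro Min_le) auto
      then have re: "r \<le> e F" using r by simp
      show "(\<forall>J. J facet_of P \<longrightarrow> s \<le> facet_dist P J (y + s *\<^sub>R facet_normal P F)) \<longleftrightarrow> y \<in> inset F (t * s)"
        if "0 \<le> s" "s \<le> r" "y \<in> affine hull F" for s y
        using slice[OF F that(1) _ that(3)] that(2) re by simp
      show "measure (flat_vol k F) (inset F (t * s)) = inset_volume k \<alpha> F (t * s)"
        if "0 \<le> s" "s \<le> r" for s
        using IH[OF F that(1)] that(2) re by simp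
      show "(layer_volume k \<alpha> F has_real_derivative inset_volume k \<alpha> F (t * s)) (at s)" for s
        unfolding t_def by (rule layer_volume_deriv)
      show "(\<lambda>s. inset_volume k \<alpha> F (t * s)) \<in> borel_measurable borel"
        unfolding inset_volume_def by measurable
    qed (rule layer_volume_0)
    have "P \<in> sets borel" using polytope_imp_closed[OF P] by (rule borel_closed)
    then have "vol (Suc k) P = measure (flat_vol (Suc k) P) P" by (rule vol_eq_flat_vol[OF dim])
    also have "\<dots> = measure (flat_vol (Suc k) P) (inset P r) + (\<Sum>F\<in>?Fs. layer_volume k \<alpha> F r)"
      using measure_inset_layers[OF P dim, of r] L by simp
    finally show ?thesis by (simp add: inset_volume_Suc)
  qed
  ultimately show ?case by blast
qed

text \<open>The distance to the boundary is the least distance to a facet hyperplane.  One inequality holds because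
\<open>l\<^sub>F\<close> is 1-Lipschitz and vanishes on \<open>F\<close>.  For the other one, the perpendicular from \<open>x\<close> to the hyperplane
of \<open>F\<close> must leave the interior of \<open>P\<close>, possibly through another facet, before it is longer than \<open>l\<^sub>F(x)\<close>.\<close>

lemma inner_parallel_eq_inset:
  fixes P :: "'a::euclidean_space set"
  assumes P: "polytope P" and full: "affine hull P = UNIV"
  shows "inner_parallel P r = inset P r"
proof -
  have fr: "frontier P = \<Union>{F. F facet_of P}"
    using rel_frontier_frontier[OF full] rel_frontier_of_polyhedron[OF polytope_imp_polyhedron[OF P]] by simp
  have "r \<le> infdist x (frontier P) \<longleftrightarrow> (\<forall>F. F facet_of P \<longrightarrow> r \<le> facet_dist P F x)" if x: "x \<in> P" for x
  proof
    assume r: "r \<le> infdist x (frontier P)"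
    show "\<forall>F. F facet_of P \<longrightarrow> r \<le> facet_dist P F x"
    proof (intro allI impI)
      fix F assume F: "F facet_of P"
      let ?h = "facet_dist P F x" and ?N = "facet_normal P F"
      have h: "?h \<ge> 0" by (rule facet_dist_nonneg[OF P F x])
      have N: "norm ?N = 1" by (rule facet_normal_props[OF P F])
      have "\<exists>a\<in>frontier P. dist x a \<le> ?h"
      proof (cases "x \<in> rel_interior P")
        case True
        let ?x = "x - ?h *\<^sub>R ?N"
        have "facet_dist P F ?x = 0" using N by (simp add: facet_dist_minus norm_eq_1)
        then have "?x \<notin> rel_interior P" using rel_interior_facet_dist_pos[OF P F] by force
        then obtain J d where J: "J facet_of P" "0 < d" "d \<le> 1" "x + d *\<^sub>R (?x - x) \<in> J"
          using ray_hits_facet[OF P True, of ?x] full by auto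
        have "dist x (x + d *\<^sub>R (?x - x)) = d * ?h" using J(2) h N by (simp add: dist_norm)
        also have "\<dots> \<le> ?h" using J(2,3) h by (intro mult_left_le_one_le) auto
        finally show ?thesis using J(1,4) fr by blast
      next
        case False
        then have "x \<in> frontier P"
          using x rel_boundary_of_polyhedron[OF polytope_imp_polyhedron[OF P]] fr by blast
        then show ?thesis using h by (intro bexI[of _ x]) auto
      qed
      then show "r \<le> ?h" using r infdist_le by (meson order_trans)
    qed
  next
    assume r: "\<forall>F. F facet_of P \<longrightarrow> r \<le> facet_dist P F x"
    have "aff_dim P = int DIM('a)"
      using full by (metis aff_dim_affine_hull aff_dim_UNIV)
    then obtain F0 where "F0 facet_of P" using polytope_facet_exists[OF P] by auto
    then have ne: "frontier P \<noteq> {}" using fr facet_of_nonempty by blast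
    show "r \<le> infdist x (frontier P)"
      unfolding infdist_notempty[OF ne]
    proof (rule cINF_greatest[OF ne])
      fix a assume "a \<in> frontier P"
      then obtain F where F: "F facet_of P" "a \<in> F" using fr by auto
      have "r \<le> facet_dist P F x - facet_dist P F a"
        using r F facet_dist_zero[OF P F] by simp
      also have "\<dots> = facet_normal P F \<bullet> (x - a)" by (rule facet_dist_diff)
      also have "\<dots> \<le> norm (facet_normal P F) * norm (x - a)" by (rule norm_cauchy_schwarz)
      finally show "r \<le> dist x a"
        using facet_normal_props(1)[OF P F(1)] by (simp add: dist_norm)
    qed
  qed
  then show ?thesis by (auto simp: inner_parallel_def inset_def)
qed

text \<open>Dimension-wise equiangularity concerns dimensions from 2 on; in dimension 1 any value in \<open>(0,\<pi>)\<close> will do.\<close>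

lemma dimensionwise_equiangular_flag_angles:
  assumes P: "polytope P" and eq: "dimensionwise_equiangular d P \<alpha>"
  shows "flag_angles d P (\<alpha>(1 := pi / 2))"
  unfolding flag_angles_def
proof (intro allI impI)
  fix j F assume j: "j < d" and F: "F face_of P" and dim: "aff_dim F = int (Suc j)"
  have pF: "polytope F" by (rule face_of_polytope_polytope[OF P F])
  show "ridge_angle F ((\<alpha>(1 := pi / 2)) (Suc j))"
  proof (cases j)
    case 0
    have "G \<inter> H = {}" if "adjacent_facets F G H" for G H
    proof -
      have "aff_dim (G \<inter> H) = -1" using that dim 0 by (simp add: adjacent_facets_def)
      then show ?thesis by (simp add: aff_dim_empty)
    qed
    then show ?thesis using 0 by (auto simp: ridge_angle_def)
  next
    case (Suc i)
    then have k: "Suc j \<in> {2..d}" "Suc j \<noteq> 1" using j by auto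
    have "equiangular F (\<alpha> (Suc j))" "0 < \<alpha> (Suc j)" "\<alpha> (Suc j) < pi"
      using eq k(1) F dim unfolding dimensionwise_equiangular_def by blast+
    moreover have "facet_normal F G \<bullet> facet_normal F H = cos (\<alpha> (Suc j))"
      if GH: "adjacent_facets F G H" for G H
    proof -
      have "G facet_of F" "H facet_of F" using GH by (auto simp: adjacent_facets_def)
      then show ?thesis
        using \<open>equiangular F (\<alpha> (Suc j))\<close> GH facet_normal[OF pF]
        unfolding equiangular_def by blast
    qed
    ultimately show ?thesis using k(2) by (simp add: ridge_angle_def)
  qed
qed

lemma inset_volume_poly: "\<exists>p. \<forall>r. inset_volume d \<alpha> P r = poly p r"
proof (intro exI allI)
  show "inset_volume d \<alpha> P r = poly (\<Sum>k=0..d. monom ((-1) ^ (d - k) * Omega d k P *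
      (\<Prod>j=k+1..d. gam d \<alpha> j) / fact (d - k)) (d - k)) r" for r
    by (simp add: inset_volume_def poly_sum poly_monom)
qed

theorem theorem2:
  fixes P :: "'a::euclidean_space set" and \<alpha> :: "nat \<Rightarrow> real" and d :: nat
  assumes "d = DIM('a)" and "1 \<le> d"
    and "compact P" and "convex P" and "interior P \<noteq> {}" and "polyhedron P"
    and "dimensionwise_equiangular d P \<alpha>"
  shows "\<exists>\<epsilon>>0.
    (\<exists>p :: real poly. \<forall>r\<in>{0..\<epsilon>}. W P r = poly p r) \<and>
    (\<forall>r\<in>{0..\<epsilon>}. W P r =
       (\<Sum>k=0..d. (-1) ^ (d - k) * Omega d k P * (\<Prod>j=k+1..d. gam d \<alpha> j)
          * (r ^ (d - k) / fact (d - k))))"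
proof -
  let ?\<alpha> = "\<alpha>(1 := pi / 2)"
  have P: "polytope P"
    using assms(3,6) by (simp add: polytope_eq_bounded_polyhedron compact_imp_bounded)
  have full: "affine hull P = UNIV" by (rule affine_hull_nonempty_interior[OF assms(5)])
  have dim: "aff_dim P = int d"
    using full assms(1) by (metis aff_dim_affine_hull aff_dim_UNIV)
  obtain \<epsilon> where e: "\<epsilon> > 0" "\<And>r. 0 \<le> r \<Longrightarrow> r \<le> \<epsilon> \<Longrightarrow>
      measure (flat_vol d P) (inset P r) = inset_volume d ?\<alpha> P r"
    using measure_inset[OF P dim dimensionwise_equiangular_flag_angles[OF P assms(7)]] by blast
  \<comment> \<open>\<open>\<gamma>\<^sub>1, \<dots>, \<gamma>\<^sub>d\<close> involve \<open>\<alpha>\<^sub>2, \<dots>, \<alpha>\<^sub>d\<close> only\<close>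
  have "gam d ?\<alpha> j = gam d \<alpha> j" if "j \<ge> 1" for j
    unfolding gam_def using that by (intro prod.cong) auto
  then have "inset_volume d ?\<alpha> P r = inset_volume d \<alpha> P r" for r
    unfolding inset_volume_def by (intro sum.cong refl arg_cong2[where f = "(*)"] prod.cong) auto
  moreover have "W P r = measure (flat_vol d P) (inset P r)" for r
    using flat_vol_full[OF full] closed_inset[OF P, of r] assms(1)
    by (simp add: W_def inner_parallel_eq_inset[OF P full] measure_completion)
  ultimately have vol: "W P r = inset_volume d \<alpha> P r" if "r \<in> {0..\<epsilon>}" for r
    using e(2)[of r] that by simp
  obtain p where "\<forall>r. inset_volume d \<alpha> P r = poly p r" using inset_volume_poly by blast
  then have "\<forall>r\<in>{0..\<epsilon>}. W P r = poly p r" using vol by simp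
  then show ?thesis
    using e(1) vol unfolding inset_volume_def[symmetric] by (intro exI[of _ \<epsilon>] conjI exI[of _ p]) auto
qed

end
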